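(* Let $m\ge 1$. One time step $f^n\mapsto f^{n+1}$ (step size $\tau>0$) of the robust and conservative dynamical low-rank integrator described in the context satisfies the following discrete version of the continuity equation: $$\frac{\rho^{n+1}-\rho^n}{\tau}+\nabla_x\cdot j^n=0 ,$$ where $\rho^{n}=\int_{\Omega_v} f^{n}\,dv$, $\rho^{n+1}=\int_{\Omega_v} f^{n+1}\,dv$ and $j^n=\int_{\Omega_v} v f^n\,dv$. Consequently the integrator preserves the total mass, i.e. $\int_{\Omega} f^{n+1}\,d(x,v)=\int_{\Omega} f^{n}\,d(x,v)$.
   Context: **Problem.** $\Omega=\Omega_x\times\Omega_v$ with $\Omega_x,\Omega_v\subset\mathbb R^d$. The Vlasov--Poisson equations are $\partial_t f=\mathrm{RHS}[f]$ with $\mathrm{RHS}[f]=-v\cdot\nabla_x f+E(f)\cdot\nabla_v f$, where $E(f)=-\nabla_x\phi$ and $-\Delta_x\phi=1-\int_{\Omega_v} f\,dv$ (so $\nabla_x\cdot E(f)=1-\int_{\Omega_v} f\,dv$). $\Omega_x$ is a box with periodic boundary conditions and $\int_{\Omega} f\,d(x,v)=|\Omega_x|$. All functions are sufficiently smooth, and sufficiently decaying in $v$, so that all integrals below exist; $\int_{\Omega_x}\nabla_x u\,dx=0$, and integration by parts in $v$ produces no boundary terms. Space and velocity are kept continuous. **Notation.** $f_{0v}>0$ is a weight function on $\Omega_v$ decaying fast enough that $1$, the components $v_1,\dots,v_d$ of $v$, and $v^2:=\sum_i v_i^2$ lie in $L^2(\Omega_v,f_{0v})$. Set $\langle a,b\rangle_x=\int_{\Omega_x}ab\,dx$,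 $\langle a,b\rangle_v=\int_{\Omega_v}f_{0v}\,ab\,dv$, $\|w\|=\sqrt{\langle w,w\rangle_v}$, $(a,b)_v=\int_{\Omega_v}ab\,dv$, $(a,b)_{xv}=\int_\Omega ab\,d(x,v)$. **Low-rank representation.** $f^n=f_{0v}\sum_{i,j=1}^r X_i^n(x)S_{ij}^nV_j^n(v)$ with $S^n\in\mathbb R^{r\times r}$, $(X_i^n)_i$ orthonormal for $\langle\cdot,\cdot\rangle_x$, $(V_j^n)_j$ orthonormal for $\langle\cdot,\cdot\rangle_v$. The first $m\le r$ functions are fixed in time: $V_a^n=U_a$ for $1\le a\le m$; the others are $V_p^n=W_p^n$ for $m<p\le r$. The fixed functions are, in this order and as far as the index does not exceed $m$: $U_1=1/\|1\|$, $U_{s+1}=v_s/\|v_s\|$ ($1\le s\le d$), $U_{d+2}=(v^2-c)/\|v^2-c\|$ with $c$ the constant making $v^2-c$ orthogonal to $1$ in $\langle\cdot,\cdot\rangle_v$ ($c=1$ for $d=1$, $f_{0v}=e^{-v^2/2}$, $\Omega_v=\mathbb R$); the weight is such that the $U_a$ are orthonormal. **One step of the integrator** (Algorithm 1), with $\mathrm{RHS}^n=\mathrm{RHS}[f^n]$: 1. Set $K_k^n=\sum_iX_i^nS_{ik}^n$ and $K_k^{n+1}=K_k^n+\tau(V_k^n,\mathrm{RHS}^n)_v$, $1\le k\le r$. Set $L_q^n=\sum_{i=1}^r\sum_{p=m+1}^r S_{iq}^nS_{ip}^nW_p^n$ and $L_q^{n+1}=L_q^n+\frac{\tau}{f_{0v}}\sum_iS_{iq}^n\langle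 X_i^n,\mathrm{RHS}^n\rangle_x-\tau\sum_{i,l}S_{iq}^n(X_i^nV_l^n,\mathrm{RHS}^n)_{xv}V_l^n$, $m+1\le q\le r$. 2. $(\widetilde X_k^{n+1})_k$ is an orthonormal basis (for $\langle\cdot,\cdot\rangle_x$) of the span of all $X_i^n$, all components of all $\nabla_xX_i^n$, and all $K_i^{n+1}$. 3. $(\widetilde V_l^{n+1})_l$ is an orthonormal basis (for $\langle\cdot,\cdot\rangle_v$) of the span of all $U_a$, $L_q^{n+1}$, $W_p^n$, chosen such that $\widetilde V_a^{n+1}=U_a$ for $a\le m$; denote the remaining functions by $\widetilde W^{n+1}$. 4. With $M_{ki}=\langle\widetilde X_k^{n+1},X_i^n\rangle_x$, $N^T_{jl}=\langle V_j^n,\widetilde V_l^{n+1}\rangle_v$ and $g=f_{0v}\sum_{k,i,j,l}\widetilde X_k^{n+1}M_{ki}S_{ij}^nN^T_{jl}\widetilde V_l^{n+1}$, set $\widetilde S_{kl}^{n+1}=\sum_{i,j}M_{ki}S_{ij}^nN^T_{jl}+\tau(\widetilde X_k^{n+1}\widetilde V_l^{n+1},\mathrm{RHS}[g])_{xv}$. 5. (Truncation to rank $r$.) Regarding families of functions as matrices whose columns are the functions, set $\widetilde K=\widetilde X^{n+1}\widetilde S^{n+1}=[\widetilde K^{cons}\ \widetilde K^{rem}]$, where $\widetilde K^{cons}$ consists of the first $m$ columns. Take QR decompositions (first factor with orthonormal columns) $\widetilde K^{cons}=X^{cons}S^{cons}$, $\widetilde K^{rem}=\widetilde X^{rem}\widetilde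 S^{rem}$. Let $\hat U\hat S\hat W^T$ be the singular value decomposition of $\widetilde S^{rem}$ truncated to the $r-m$ largest singular values; set $X^{rem}=\widetilde X^{rem}\hat U$, $S^{rem}=\hat S$, $W^{n+1}=\widetilde W^{n+1}\hat W$, $V^{n+1}=[U\ W^{n+1}]$. Take a QR decomposition $[X^{cons}\ X^{rem}]=X^{n+1}R$ and set $S^{n+1}=R\begin{bmatrix}S^{cons}&0\\0&S^{rem}\end{bmatrix}$. 6. $f^{n+1}=f_{0v}\sum_{i,j=1}^rX_i^{n+1}S_{ij}^{n+1}V_j^{n+1}$. *)

theory Defs
  imports "HOL-Analysis.Analysis"
begin

section \<open>Calculus on \<open>\<real>\<^sup>d\<close>\<close>

definition grad :: "(real^'d \<Rightarrow> real) \<Rightarrow> real^'d \<Rightarrow> real^'d" where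
  "grad u x = (\<chi> s. frechet_derivative u (at x) (axis s 1))"

definition divergence :: "(real^'d \<Rightarrow> real^'d) \<Rightarrow> real^'d \<Rightarrow> real" where
  "divergence F x = (\<Sum>s\<in>UNIV. grad (\<lambda>y. F y $ s) x $ s)"

text \<open>Only used for open \<open>A\<close>.\<close>

definition C1_on :: "(real^'d) set \<Rightarrow> (real^'d \<Rightarrow> real) \<Rightarrow> bool" where
  "C1_on A u \<longleftrightarrow> (\<forall>x\<in>A. u differentiable (at x)) \<and> continuous_on A (grad u)"

definition in_L2 :: "(real^'d) set \<Rightarrow> (real^'d \<Rightarrow> real) \<Rightarrow> (real^'d \<Rightarrow> real) \<Rightarrow> bool" where
  "in_L2 A w u \<longleftrightarrow> set_borel_measurable lborel A u \<and> set_integrable lborel A (\<lambda>x. w x * (u x)\<^sup>2)"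

text \<open>Linear span of a finite set \<open>F\<close> of functions, where functions are identified if they
  agree on \<open>A\<close>.\<close>

definition fspan :: "'a set \<Rightarrow> ('a \<Rightarrow> real) set \<Rightarrow> ('a \<Rightarrow> real) set" where
  "fspan A F = {h. \<exists>c. \<forall>x\<in>A. h x = (\<Sum>u\<in>F. c u * u x)}"

section \<open>Matrices\<close>

text \<open>Matrices and families are indexed from \<open>1\<close>; entries outside the stated range are irrelevant.\<close>

definition upper_triangular :: "nat \<Rightarrow> (nat \<Rightarrow> nat \<Rightarrow> real) \<Rightarrow> bool" where
  "upper_triangular n R \<longleftrightarrow> (\<forall>i\<in>{1..n}. \<forall>j\<in>{1..n}. j < i \<longrightarrow> R i j = 0)"

definition orthogonal_mat :: "nat \<Rightarrow> (nat \<Rightarrow> nat \<Rightarrow> real) \<Rightarrow> bool" where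
  "orthogonal_mat n Q \<longleftrightarrow>
     (\<forall>i\<in>{1..n}. \<forall>j\<in>{1..n}. (\<Sum>k=1..n. Q k i * Q k j) = (if i = j then 1 else 0))"

definition is_svd ::
  "nat \<Rightarrow> (nat \<Rightarrow> nat \<Rightarrow> real) \<Rightarrow> (nat \<Rightarrow> nat \<Rightarrow> real) \<Rightarrow> (nat \<Rightarrow> real) \<Rightarrow> (nat \<Rightarrow> nat \<Rightarrow> real) \<Rightarrow> bool" where
  "is_svd n A P \<sigma> Q \<longleftrightarrow>
     orthogonal_mat n P \<and> orthogonal_mat n Q \<and>
     (\<forall>i\<in>{1..n}. 0 \<le> \<sigma> i) \<and> (\<forall>i\<in>{1..n}. \<forall>j\<in>{1..n}. i \<le> j \<longrightarrow> \<sigma> j \<le> \<sigma> i) \<and>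
     (\<forall>i\<in>{1..n}. \<forall>j\<in>{1..n}. A i j = (\<Sum>k=1..n. P i k * \<sigma> k * Q j k))"

section \<open>The Vlasov--Poisson problem\<close>

text \<open>
  The spatial domain is the box with corners \<open>lo\<close> and \<open>hi\<close>; functions on it with periodic boundary
  conditions are represented by their periodic extensions to \<open>\<real>\<^sup>d\<close>. Functions on the open set
  \<open>\<Omega>\<^sub>v\<close> are represented by functions on \<open>\<real>\<^sup>d\<close> whose values outside \<open>\<Omega>\<^sub>v\<close> are irrelevant.
  The bijection \<open>e\<close> fixes the numbering \<open>v\<^sub>1, \<dots>, v\<^sub>d\<close> of the components of \<open>v\<close>.
\<close>

locale vp_setting =
  fixes lo hi :: "real^'d"
    and \<Omega>\<^sub>v :: "(real^'d) set"
    and f0v :: "real^'d \<Rightarrow> real"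
    and e :: "nat \<Rightarrow> 'd"
    and c :: real
  assumes box_nonempty: "\<And>s. lo $ s < hi $ s"
    and open_\<Omega>\<^sub>v: "open \<Omega>\<^sub>v"
    and weight_pos: "\<And>v. v \<in> \<Omega>\<^sub>v \<Longrightarrow> 0 < f0v v"
    and weight_C1: "C1_on \<Omega>\<^sub>v f0v"
    and weight_L2_1: "in_L2 \<Omega>\<^sub>v f0v (\<lambda>v. 1)"
    and weight_L2_v: "\<And>s. in_L2 \<Omega>\<^sub>v f0v (\<lambda>v. v $ s)"
    and weight_L2_v2: "in_L2 \<Omega>\<^sub>v f0v (\<lambda>v. v \<bullet> v)"
    and numbering: "bij_betw e {1..CARD('d)} UNIV"
    and c_orth: "(LINT v:\<Omega>\<^sub>v|lborel. f0v v * ((v \<bullet> v - c) * 1)) = 0"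
begin

definition \<Omega>\<^sub>x :: "(real^'d) set" where
  "\<Omega>\<^sub>x = cbox lo hi"

definition periodic :: "(real^'d \<Rightarrow> real) \<Rightarrow> bool" where
  "periodic u \<longleftrightarrow> (\<forall>x s. u (x + axis s (hi $ s - lo $ s)) = u x)"

definition ip_x :: "(real^'d \<Rightarrow> real) \<Rightarrow> (real^'d \<Rightarrow> real) \<Rightarrow> real" where
  "ip_x a b = (LINT x:\<Omega>\<^sub>x|lborel. a x * b x)"

definition ip_v :: "(real^'d \<Rightarrow> real) \<Rightarrow> (real^'d \<Rightarrow> real) \<Rightarrow> real" where
  "ip_v a b = (LINT v:\<Omega>\<^sub>v|lborel. f0v v * (a v * b v))"

definition norm_v :: "(real^'d \<Rightarrow> real) \<Rightarrow> real" where
  "norm_v w = sqrt (ip_v w w)"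

definition pair_v :: "(real^'d \<Rightarrow> real) \<Rightarrow> (real^'d \<Rightarrow> real) \<Rightarrow> real" where
  "pair_v a b = (LINT v:\<Omega>\<^sub>v|lborel. a v * b v)"

definition pair_xv :: "(real^'d \<Rightarrow> real^'d \<Rightarrow> real) \<Rightarrow> (real^'d \<Rightarrow> real^'d \<Rightarrow> real) \<Rightarrow> real" where
  "pair_xv a b = (LINT (x, v):(\<Omega>\<^sub>x \<times> \<Omega>\<^sub>v)|lborel. a x v * b x v)"

definition density :: "(real^'d \<Rightarrow> real^'d \<Rightarrow> real) \<Rightarrow> real^'d \<Rightarrow> real" where
  "density f x = (LINT v:\<Omega>\<^sub>v|lborel. f x v)"

definition current :: "(real^'d \<Rightarrow> real^'d \<Rightarrow> real) \<Rightarrow> real^'d \<Rightarrow> real^'d" where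
  "current f x = (LINT v:\<Omega>\<^sub>v|lborel. f x v *\<^sub>R v)"

definition mass :: "(real^'d \<Rightarrow> real^'d \<Rightarrow> real) \<Rightarrow> real" where
  "mass f = (LINT (x, v):(\<Omega>\<^sub>x \<times> \<Omega>\<^sub>v)|lborel. f x v)"

definition is_potential :: "(real^'d \<Rightarrow> real^'d \<Rightarrow> real) \<Rightarrow> (real^'d \<Rightarrow> real) \<Rightarrow> bool" where
  "is_potential f \<phi> \<longleftrightarrow>
     periodic \<phi> \<and> C1_on UNIV \<phi> \<and> (\<forall>s. C1_on UNIV (\<lambda>x. grad \<phi> x $ s)) \<and>
     (\<forall>x. - divergence (grad \<phi>) x = 1 - density f x)"

text \<open>Periodic potentials of the same \<open>f\<close> differ by a constant, so the choice does not matter.\<close>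

definition efield :: "(real^'d \<Rightarrow> real^'d \<Rightarrow> real) \<Rightarrow> real^'d \<Rightarrow> real^'d" where
  "efield f x = - grad (SOME \<phi>. is_potential f \<phi>) x"

definition RHS :: "(real^'d \<Rightarrow> real^'d \<Rightarrow> real) \<Rightarrow> real^'d \<Rightarrow> real^'d \<Rightarrow> real" where
  "RHS f x v = - (v \<bullet> grad (\<lambda>y. f y v) x) + efield f x \<bullet> grad (f x) v"

section \<open>Low-rank representation\<close>

definition orthonormal_x :: "nat \<Rightarrow> (nat \<Rightarrow> real^'d \<Rightarrow> real) \<Rightarrow> bool" where
  "orthonormal_x n B \<longleftrightarrow>
     (\<forall>i\<in>{1..n}. periodic (B i) \<and> in_L2 \<Omega>\<^sub>x (\<lambda>x. 1) (B i)) \<and>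
     (\<forall>i\<in>{1..n}. \<forall>j\<in>{1..n}. ip_x (B i) (B j) = (if i = j then 1 else 0))"

definition orthonormal_v :: "nat \<Rightarrow> (nat \<Rightarrow> real^'d \<Rightarrow> real) \<Rightarrow> bool" where
  "orthonormal_v n B \<longleftrightarrow>
     (\<forall>i\<in>{1..n}. in_L2 \<Omega>\<^sub>v f0v (B i)) \<and>
     (\<forall>i\<in>{1..n}. \<forall>j\<in>{1..n}. ip_v (B i) (B j) = (if i = j then 1 else 0))"

definition U :: "nat \<Rightarrow> real^'d \<Rightarrow> real" where
  "U a v =
     (if a = 1 then 1 / norm_v (\<lambda>w. 1)
      else if a \<le> CARD('d) + 1 then v $ e (a - 1) / norm_v (\<lambda>w. w $ e (a - 1))
      else (v \<bullet> v - c) / norm_v (\<lambda>w. w \<bullet> w - c))"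

definition lowrank ::
  "nat \<Rightarrow> (nat \<Rightarrow> real^'d \<Rightarrow> real) \<Rightarrow> (nat \<Rightarrow> nat \<Rightarrow> real) \<Rightarrow> (nat \<Rightarrow> real^'d \<Rightarrow> real) \<Rightarrow>
   real^'d \<Rightarrow> real^'d \<Rightarrow> real" where
  "lowrank r X S V x v = f0v v * (\<Sum>i=1..r. \<Sum>j=1..r. X i x * S i j * V j v)"

text \<open>
  The square-integrability conditions on \<open>v\<^sub>s V\<^sub>j\<close> and
  \<open>\<partial>\<^sub>s (f\<^sub>0\<^sub>v V\<^sub>j) / f\<^sub>0\<^sub>v\<close> ensure that \<open>RHS / f\<^sub>0\<^sub>v\<close> is again in \<open>L\<^sup>2(\<Omega>\<^sub>v, f\<^sub>0\<^sub>v)\<close>, so that all integrals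
  in the algorithm exist; the last condition on \<open>V\<close> is integration by parts without boundary terms. That the
  first \<open>m\<close> functions \<open>U\<^sub>a\<close> are orthonormal is part of the orthonormality of \<open>V\<close>.
\<close>

definition lowrank_state ::
  "nat \<Rightarrow> nat \<Rightarrow> (nat \<Rightarrow> real^'d \<Rightarrow> real) \<Rightarrow> (nat \<Rightarrow> nat \<Rightarrow> real) \<Rightarrow> (nat \<Rightarrow> real^'d \<Rightarrow> real) \<Rightarrow> bool" where
  "lowrank_state r m X S V \<longleftrightarrow>
     m \<le> r \<and> m \<le> CARD('d) + 2 \<and>
     orthonormal_x r X \<and> (\<forall>i\<in>{1..r}. C1_on UNIV (X i)) \<and>
     orthonormal_v r V \<and> (\<forall>j\<in>{1..r}. C1_on \<Omega>\<^sub>v (V j)) \<and>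
     (\<forall>a\<in>{1..m}. \<forall>v\<in>\<Omega>\<^sub>v. V a v = U a v) \<and>
     (\<forall>j\<in>{1..r}. \<forall>s. in_L2 \<Omega>\<^sub>v f0v (\<lambda>v. v $ s * V j v) \<and>
        in_L2 \<Omega>\<^sub>v f0v (\<lambda>v. grad (\<lambda>w. f0v w * V j w) v $ s / f0v v)) \<and>
     (\<forall>k\<in>{1..r}. \<forall>j\<in>{1..r}. \<forall>s.
        set_integrable lborel \<Omega>\<^sub>v (\<lambda>v. V k v * grad (\<lambda>w. f0v w * V j w) v $ s) \<and>
        set_integrable lborel \<Omega>\<^sub>v (\<lambda>v. grad (V k) v $ s * (f0v v * V j v)) \<and>
        (LINT v:\<Omega>\<^sub>v|lborel. V k v * grad (\<lambda>w. f0v w * V j w) v $ s)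
          = - (LINT v:\<Omega>\<^sub>v|lborel. grad (V k) v $ s * (f0v v * V j v))) \<and>
     mass (lowrank r X S V) = measure lborel \<Omega>\<^sub>x \<and>
     (\<exists>\<phi>. is_potential (lowrank r X S V) \<phi>)"

section \<open>One step of the integrator\<close>

definition K_old ::
  "nat \<Rightarrow> (nat \<Rightarrow> real^'d \<Rightarrow> real) \<Rightarrow> (nat \<Rightarrow> nat \<Rightarrow> real) \<Rightarrow> nat \<Rightarrow> real^'d \<Rightarrow> real" where
  "K_old r X S k x = (\<Sum>i=1..r. X i x * S i k)"

definition K_new ::
  "real \<Rightarrow> nat \<Rightarrow> (nat \<Rightarrow> real^'d \<Rightarrow> real) \<Rightarrow> (nat \<Rightarrow> nat \<Rightarrow> real) \<Rightarrow> (nat \<Rightarrow> real^'d \<Rightarrow> real) \<Rightarrow>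
   nat \<Rightarrow> real^'d \<Rightarrow> real" where
  "K_new \<tau> r X S V k x = K_old r X S k x + \<tau> * pair_v (V k) (RHS (lowrank r X S V) x)"

definition L_old ::
  "nat \<Rightarrow> nat \<Rightarrow> (nat \<Rightarrow> nat \<Rightarrow> real) \<Rightarrow> (nat \<Rightarrow> real^'d \<Rightarrow> real) \<Rightarrow> nat \<Rightarrow> real^'d \<Rightarrow> real" where
  "L_old r m S V q v = (\<Sum>i=1..r. \<Sum>p=m+1..r. S i q * S i p * V p v)"

definition L_new ::
  "real \<Rightarrow> nat \<Rightarrow> nat \<Rightarrow> (nat \<Rightarrow> real^'d \<Rightarrow> real) \<Rightarrow> (nat \<Rightarrow> nat \<Rightarrow> real) \<Rightarrow> (nat \<Rightarrow> real^'d \<Rightarrow> real) \<Rightarrow>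
   nat \<Rightarrow> real^'d \<Rightarrow> real" where
  "L_new \<tau> r m X S V q v =
     (let F = RHS (lowrank r X S V) in
      L_old r m S V q v
      + \<tau> / f0v v * (\<Sum>i=1..r. S i q * ip_x (X i) (\<lambda>x. F x v))
      - \<tau> * (\<Sum>i=1..r. \<Sum>l=1..r. S i q * pair_xv (\<lambda>x w. X i x * V l w) F * V l v))"

definition augmented_X ::
  "real \<Rightarrow> nat \<Rightarrow> (nat \<Rightarrow> real^'d \<Rightarrow> real) \<Rightarrow> (nat \<Rightarrow> nat \<Rightarrow> real) \<Rightarrow> (nat \<Rightarrow> real^'d \<Rightarrow> real) \<Rightarrow>
   nat \<Rightarrow> (nat \<Rightarrow> real^'d \<Rightarrow> real) \<Rightarrow> bool" where
  "augmented_X \<tau> r X S V Nx Xt \<longleftrightarrow>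
     orthonormal_x Nx Xt \<and>
     fspan UNIV (Xt ` {1..Nx}) =
       fspan UNIV (X ` {1..r} \<union> {(\<lambda>x. grad (X i) x $ s) |i s. i \<in> {1..r}} \<union> K_new \<tau> r X S V ` {1..r})"

definition augmented_V ::
  "real \<Rightarrow> nat \<Rightarrow> nat \<Rightarrow> (nat \<Rightarrow> real^'d \<Rightarrow> real) \<Rightarrow> (nat \<Rightarrow> nat \<Rightarrow> real) \<Rightarrow> (nat \<Rightarrow> real^'d \<Rightarrow> real) \<Rightarrow>
   nat \<Rightarrow> (nat \<Rightarrow> real^'d \<Rightarrow> real) \<Rightarrow> bool" where
  "augmented_V \<tau> r m X S V Nv Vt \<longleftrightarrow>
     orthonormal_v Nv Vt \<and>
     fspan \<Omega>\<^sub>v (Vt ` {1..Nv}) =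
       fspan \<Omega>\<^sub>v (U ` {1..m} \<union> L_new \<tau> r m X S V ` {m+1..r} \<union> V ` {m+1..r}) \<and>
     m \<le> Nv \<and> (\<forall>a\<in>{1..m}. \<forall>v\<in>\<Omega>\<^sub>v. Vt a v = U a v)"

text \<open>The coefficients \<open>M S N\<^sup>T\<close> of \<open>f\<^sup>n\<close> projected onto the augmented bases.\<close>

definition S_proj ::
  "nat \<Rightarrow> (nat \<Rightarrow> real^'d \<Rightarrow> real) \<Rightarrow> (nat \<Rightarrow> nat \<Rightarrow> real) \<Rightarrow> (nat \<Rightarrow> real^'d \<Rightarrow> real) \<Rightarrow>
   (nat \<Rightarrow> real^'d \<Rightarrow> real) \<Rightarrow> (nat \<Rightarrow> real^'d \<Rightarrow> real) \<Rightarrow> nat \<Rightarrow> nat \<Rightarrow> real" where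
  "S_proj r X S V Xt Vt k l =
     (\<Sum>i=1..r. \<Sum>j=1..r. ip_x (Xt k) (X i) * S i j * ip_v (V j) (Vt l))"

definition f_proj ::
  "nat \<Rightarrow> (nat \<Rightarrow> real^'d \<Rightarrow> real) \<Rightarrow> (nat \<Rightarrow> nat \<Rightarrow> real) \<Rightarrow> (nat \<Rightarrow> real^'d \<Rightarrow> real) \<Rightarrow>
   nat \<Rightarrow> (nat \<Rightarrow> real^'d \<Rightarrow> real) \<Rightarrow> nat \<Rightarrow> (nat \<Rightarrow> real^'d \<Rightarrow> real) \<Rightarrow>
   real^'d \<Rightarrow> real^'d \<Rightarrow> real" where
  "f_proj r X S V Nx Xt Nv Vt x v =
     f0v v * (\<Sum>k=1..Nx. \<Sum>l=1..Nv. Xt k x * S_proj r X S V Xt Vt k l * Vt l v)"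

definition S_new ::
  "real \<Rightarrow> nat \<Rightarrow> (nat \<Rightarrow> real^'d \<Rightarrow> real) \<Rightarrow> (nat \<Rightarrow> nat \<Rightarrow> real) \<Rightarrow> (nat \<Rightarrow> real^'d \<Rightarrow> real) \<Rightarrow>
   nat \<Rightarrow> (nat \<Rightarrow> real^'d \<Rightarrow> real) \<Rightarrow> nat \<Rightarrow> (nat \<Rightarrow> real^'d \<Rightarrow> real) \<Rightarrow> nat \<Rightarrow> nat \<Rightarrow> real" where
  "S_new \<tau> r X S V Nx Xt Nv Vt k l =
     S_proj r X S V Xt Vt k l
     + \<tau> * pair_xv (\<lambda>x v. Xt k x * Vt l v) (RHS (f_proj r X S V Nx Xt Nv Vt))"

definition is_qr ::
  "nat \<Rightarrow> (nat \<Rightarrow> real^'d \<Rightarrow> real) \<Rightarrow> (nat \<Rightarrow> real^'d \<Rightarrow> real) \<Rightarrow> (nat \<Rightarrow> nat \<Rightarrow> real) \<Rightarrow> bool" where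
  "is_qr n B Q R \<longleftrightarrow>
     orthonormal_x n Q \<and> upper_triangular n R \<and>
     (\<forall>j\<in>{1..n}. \<forall>x. B j x = (\<Sum>i=1..n. Q i x * R i j))"

text \<open>
  \<open>P\<close>, \<open>\<sigma>\<close>, \<open>Q\<close> is the full singular value decomposition of \<open>Sr\<close>, of size \<open>Nv - m\<close>; its truncation
  keeps the first \<open>r - m\<close> columns of \<open>P\<close> and \<open>Q\<close> and the first \<open>r - m\<close> singular values.
\<close>

definition truncation ::
  "nat \<Rightarrow> nat \<Rightarrow> nat \<Rightarrow> (nat \<Rightarrow> real^'d \<Rightarrow> real) \<Rightarrow> nat \<Rightarrow> (nat \<Rightarrow> real^'d \<Rightarrow> real) \<Rightarrow> (nat \<Rightarrow> nat \<Rightarrow> real) \<Rightarrow>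
   (nat \<Rightarrow> real^'d \<Rightarrow> real) \<Rightarrow> (nat \<Rightarrow> nat \<Rightarrow> real) \<Rightarrow> (nat \<Rightarrow> real^'d \<Rightarrow> real) \<Rightarrow> bool" where
  "truncation r m Nx Xt Nv Vt St X' S' V' \<longleftrightarrow>
     (\<exists>Xc Sc Xr Sr P \<sigma> Q R.
        let Kt = (\<lambda>l x. \<Sum>k=1..Nx. Xt k x * St k l);
            Y = (\<lambda>j x. if j \<le> m then Xc j x else (\<Sum>i=1..Nv-m. Xr i x * P i (j - m)));
            B = (\<lambda>i j. if i \<le> m \<and> j \<le> m then Sc i j
                       else if m < i \<and> i = j then \<sigma> (i - m) else 0)
        in is_qr m Kt Xc Sc \<and>
           is_qr (Nv - m) (\<lambda>l. Kt (m + l)) Xr Sr \<and>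
           is_svd (Nv - m) Sr P \<sigma> Q \<and>
           (\<forall>a\<in>{1..m}. \<forall>v\<in>\<Omega>\<^sub>v. V' a v = U a v) \<and>
           (\<forall>j\<in>{1..r-m}. \<forall>v\<in>\<Omega>\<^sub>v. V' (m + j) v = (\<Sum>i=1..Nv-m. Vt (m + i) v * Q i j)) \<and>
           is_qr r Y X' R \<and>
           (\<forall>i\<in>{1..r}. \<forall>j\<in>{1..r}. S' i j = (\<Sum>k=1..r. R i k * B k j)))"

definition dlr_step ::
  "real \<Rightarrow> nat \<Rightarrow> nat \<Rightarrow>
   (nat \<Rightarrow> real^'d \<Rightarrow> real) \<Rightarrow> (nat \<Rightarrow> nat \<Rightarrow> real) \<Rightarrow> (nat \<Rightarrow> real^'d \<Rightarrow> real) \<Rightarrow>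
   (nat \<Rightarrow> real^'d \<Rightarrow> real) \<Rightarrow> (nat \<Rightarrow> nat \<Rightarrow> real) \<Rightarrow> (nat \<Rightarrow> real^'d \<Rightarrow> real) \<Rightarrow> bool" where
  "dlr_step \<tau> r m X S V X' S' V' \<longleftrightarrow>
     (\<exists>Nx Xt Nv Vt.
        augmented_X \<tau> r X S V Nx Xt \<and>
        augmented_V \<tau> r m X S V Nv Vt \<and>
        truncation r m Nx Xt Nv Vt (S_new \<tau> r X S V Nx Xt Nv Vt) X' S' V')"

end

end

theory Submission
  imports Defs
begin

text \<open>
  Write \<open>f = f\<^sub>0\<^sub>v \<Sum>\<^sub>j K\<^sub>j V\<^sub>j\<close> with \<open>K\<^sub>j = \<Sum>\<^sub>i X\<^sub>i S\<^sub>i\<^sub>j\<close>, and \<open>\<parallel>1\<parallel>\<close> for the norm of the constant function.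
  The first velocity basis function is \<open>U\<^sub>1 = 1/\<parallel>1\<parallel>\<close> and the others are orthogonal to it, so the
  density of \<open>f\<close> is \<open>\<rho> = \<parallel>1\<parallel> K\<^sub>1\<close> (\<open>moments_orthonormal_v\<close>, \<open>density_mass_lowrank\<close>). It therefore
  suffices to follow \<open>K\<^sub>1\<close> through one step.

  The truncation leaves the first \<open>m\<close> columns of the updated coefficients unchanged, so the new first
  coefficient is the first column of the augmented basis times the updated matrix
  (\<open>truncation_first_column\<close>). The spans of the augmented bases contain the old bases. Hence the
  projection \<open>g\<close> of \<open>f\<close> onto them coincides with \<open>f\<close> on \<open>\<Omega>\<^sub>v\<close> (\<open>f_proj_eq_lowrank\<close>), which gives
  \<open>RHS g = RHS f\<close> there (\<open>RHS_cong\<close>), and the contribution of the projected coefficients to the first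
  column is \<open>K\<^sub>1\<close> (\<open>S_proj_first_column\<close>).

  It remains to find the increment, whose coefficients are \<open>\<tau>\<close> times the integrals of \<open>RHS f\<close> against the
  products of the augmented functions \<open>B\<^sub>k\<close> of \<open>x\<close> with \<open>U\<^sub>1\<close>. The force term drops out by integration
  by parts in \<open>v\<close>, because \<open>U\<^sub>1\<close> is constant; the transport term gives
  \<open>- \<Sum>\<^sub>j\<^sub>,\<^sub>s \<langle>B\<^sub>k, \<partial>\<^sub>s K\<^sub>j\<rangle> \<langle>U\<^sub>1, v\<^sub>s V\<^sub>j\<rangle>\<close> (\<open>pair_xv_RHS\<close>). All derivatives \<open>\<partial>\<^sub>s X\<^sub>i\<close> lie in the span of
  the \<open>B\<^sub>k\<close>, so summing these values against the \<open>B\<^sub>k\<close> reproduces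
  \<open>- \<Sum>\<^sub>j\<^sub>,\<^sub>s \<partial>\<^sub>s K\<^sub>j \<langle>U\<^sub>1, v\<^sub>s V\<^sub>j\<rangle>\<close> without projection error (\<open>dlr_step_first_coefficient\<close>). Multiplied by
  \<open>\<parallel>1\<parallel>\<close>, this is minus the divergence of the current (\<open>divergence_current\<close>), which is the continuity
  equation.

  The mass of \<open>f\<close> is \<open>\<parallel>1\<parallel>\<close> times the integral of \<open>K\<^sub>1\<close> over the box, and the increment of \<open>K\<^sub>1\<close>
  integrates to zero, because the integral of \<open>\<partial>\<^sub>s u\<close> over the box vanishes for every periodic \<open>C\<^sup>1\<close>
  function \<open>u\<close> (\<open>integral_cbox_partial_eq_0\<close>).
\<close>

section \<open>Gradients and periodic functions on a box\<close>

lemma integral_cbox_periodic_shift: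
  fixes h :: "real^'d \<Rightarrow> real"
  assumes cont: "continuous_on UNIV h"
    and per: "\<And>x. h (x + axis s (b $ s - a $ s)) = h x"
    and t: "0 \<le> t" "t \<le> b $ s - a $ s"
  shows "integral (cbox a b) (\<lambda>x. h (x + axis s t)) = integral (cbox a b) h"
proof -
  let ?e = "axis s 1 :: real^'d"
  define q p where "q = axis s t" and "p = axis s (b $ s - a $ s)"
  define b1 where "b1 = (\<chi> i. if i = s then a $ s + t else b $ i)"
  have [simp]: "q $ i = (if i = s then t else 0)" "p $ i = (if i = s then b $ s - a $ s else 0)" for i
    by (simp_all add: q_def p_def axis_def)
  \<comment> \<open>The box enlarged by \<open>t\<close> in direction \<open>s\<close> is cut twice: into the shifted box and a slab at its
    lower end, and into the original box and a slab at its upper end. The two slabs differ by a period.\<close>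
  have int: "h integrable_on cbox a (b + q)"
    by (rule integrable_continuous[OF continuous_on_subset[OF cont]]) simp
  have e: "?e \<in> Basis"
    by simp
  have coord: "x \<bullet> ?e = x $ s" for x :: "real^'d"
    by (simp add: inner_axis)
  have mem: "x \<in> cbox a b \<longleftrightarrow> a $ s \<le> x $ s \<and> x $ s \<le> b $ s \<and> (\<forall>i. i \<noteq> s \<longrightarrow> a $ i \<le> x $ i \<and> x $ i \<le> b $ i)"
    for x a b :: "real^'d"
    unfolding mem_box_cart by metis
  note split = integral_split[OF int e, unfolded coord]
  have "cbox a (b + q) \<inter> {x. x $ s \<le> a $ s + t} = cbox a b1"
    using t by (auto simp: set_eq_iff mem b1_def)
  moreover have "cbox a (b + q) \<inter> {x. x $ s \<ge> a $ s + t} = cbox (a + q) (b + q)"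
    using t by (auto simp: set_eq_iff mem)
  ultimately have 1: "integral (cbox a (b + q)) h = integral (cbox a b1) h + integral (cbox (a + q) (b + q)) h"
    using split[of "a $ s + t"] by simp
  have "cbox a (b + q) \<inter> {x. x $ s \<le> b $ s} = cbox a b"
    using t by (auto simp: set_eq_iff mem)
  moreover have "cbox a (b + q) \<inter> {x. x $ s \<ge> b $ s} = cbox (a + p) (b1 + p)"
    using t by (auto simp: set_eq_iff mem b1_def)
  ultimately have 2: "integral (cbox a (b + q)) h = integral (cbox a b) h + integral (cbox (a + p) (b1 + p)) h"
    using split[of "b $ s"] by simp
  have "integral (cbox (a + p) (b1 + p)) h = integral (cbox a b1) (h \<circ> (+) p)"
    by (rule integral_shift_cbox_plus[symmetric])
  also have "h \<circ> (+) p = h"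
    using per by (auto simp: p_def add.commute)
  finally have "integral (cbox (a + q) (b + q)) h = integral (cbox a b) h"
    using 1 2 by simp
  then show ?thesis
    using integral_shift_cbox_plus[of a b h q] by (simp add: q_def comp_def add.commute)
qed

lemma has_derivative_grad:
  fixes u :: "real^'d \<Rightarrow> real"
  assumes "u differentiable (at x)"
  shows "(u has_derivative (\<lambda>h. grad u x \<bullet> h)) (at x)"
proof -
  let ?D = "frechet_derivative u (at x)"
  have D: "(u has_derivative ?D) (at x)"
    using assms by (simp add: frechet_derivative_works)
  have lin: "linear ?D"
    using D has_derivative_linear by blast
  have "?D h = grad u x \<bullet> h" for h
  proof -
    have "?D h = ?D (\<Sum>s\<in>UNIV. h $ s *\<^sub>R axis s 1)"
      by (metis basis_expansion scalar_mult_eq_scaleR)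
    also have "\<dots> = (\<Sum>s\<in>UNIV. h $ s * ?D (axis s 1))"
      by (simp add: linear_sum[OF lin] linear_scale[OF lin])
    also have "\<dots> = grad u x \<bullet> h"
      by (simp add: grad_def inner_vec_def mult.commute)
    finally show ?thesis .
  qed
  then have "?D = (\<lambda>h. grad u x \<bullet> h)" by blast
  with D show ?thesis by simp
qed

lemma grad_unique:
  fixes u :: "real^'d \<Rightarrow> real"
  assumes "(u has_derivative (\<lambda>h. g \<bullet> h)) (at x)"
  shows "grad u x = g"
  using frechet_derivative_at[OF assms, symmetric] by (simp add: grad_def vec_eq_iff inner_axis)

lemma grad_const [simp]: "grad (\<lambda>x. k) x = 0"
  by (rule grad_unique) simp

text \<open>
  No differentiability is assumed: where there is no derivative, \<open>grad\<close> makes the same arbitrary choice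
  for both functions.
\<close>

lemma grad_cong_open:
  fixes u w :: "real^'d \<Rightarrow> real"
  assumes "open A" "x \<in> A" "\<And>y. y \<in> A \<Longrightarrow> u y = w y"
  shows "grad u x = grad w x"
proof -
  have "(u has_derivative D) (at x) \<longleftrightarrow> (w has_derivative D) (at x)" for D
    using has_derivative_transform_within_open[of u D x UNIV A w]
      has_derivative_transform_within_open[of w D x UNIV A u] assms by auto
  then show ?thesis
    by (simp add: grad_def frechet_derivative_def)
qed

lemma C1_on_imp_continuous_on:
  assumes "C1_on A u"
  shows "continuous_on A u"
proof (rule continuous_at_imp_continuous_on, rule ballI)
  fix x assume "x \<in> A"
  then show "isCont u x"
    using assms unfolding C1_on_def by (intro differentiable_imp_continuous_within) blast
qed

lemma grad_sum_mult:
  fixes u :: "'i \<Rightarrow> real^'d \<Rightarrow> real"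
  assumes "\<And>i. i \<in> I \<Longrightarrow> u i differentiable (at x)"
  shows "grad (\<lambda>y. \<Sum>i\<in>I. a i * u i y) x = (\<Sum>i\<in>I. a i *\<^sub>R grad (u i) x)"
proof (rule grad_unique)
  have "((\<lambda>y. \<Sum>i\<in>I. a i * u i y) has_derivative (\<lambda>h. \<Sum>i\<in>I. a i * (grad (u i) x \<bullet> h))) (at x)"
    using assms by (intro has_derivative_sum has_derivative_mult_right has_derivative_grad) auto
  then show "((\<lambda>y. \<Sum>i\<in>I. a i * u i y) has_derivative (\<lambda>h. (\<Sum>i\<in>I. a i *\<^sub>R grad (u i) x) \<bullet> h)) (at x)"
    by (simp add: inner_sum_left)
qed

text \<open>
  Integrating \<open>\<partial>\<^sub>s u\<close> over one period \<open>0 \<le> t \<le> L\<close> along the line \<open>x + t e\<^sub>s\<close> gives zero for every \<open>x\<close>. Integrating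
  this over \<open>x\<close> and exchanging the integrals yields \<open>L\<close> times the integral in question, because
  the integral of a periodic function over the box is invariant under shifts.
\<close>

lemma integral_cbox_partial_eq_0:
  fixes u :: "real^'d \<Rightarrow> real"
  assumes C1: "C1_on UNIV u"
    and per: "\<And>x. u (x + axis s (b $ s - a $ s)) = u x"
    and ab: "a $ s < b $ s"
  shows "integral (cbox a b) (\<lambda>x. grad u x $ s) = 0"
proof -
  define L where "L = b $ s - a $ s"
  define h where "h = (\<lambda>x. grad u x $ s)"
  have L: "0 < L" using ab by (simp add: L_def)
  have diff: "u differentiable (at x)" for x
    using C1 by (simp add: C1_on_def)
  have cont: "continuous_on UNIV h"
    using C1 unfolding C1_on_def h_def by (intro continuous_intros) auto
  have hper: "h (x + axis s (b $ s - a $ s)) = h x" for x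
  proof -
    let ?p = "axis s (b $ s - a $ s) :: real^'d"
    have "((\<lambda>y. u (y + ?p)) has_derivative (\<lambda>k. grad u (x + ?p) \<bullet> k)) (at x)"
      by (rule has_derivative_compose[where g=u and f="\<lambda>y. y + ?p" and f'="\<lambda>k. k", OF _ has_derivative_grad[OF diff]])
        (auto intro!: derivative_eq_intros)
    then have "grad (\<lambda>y. u (y + ?p)) x = grad u (x + ?p)"
      by (rule grad_unique)
    then show ?thesis
      by (simp add: per h_def)
  qed
  have ax: "t *\<^sub>R (axis s 1 :: real^'d) = axis s t" for t
    by (simp add: vec_eq_iff axis_def)
  have FTC: "integral (cbox 0 L) (\<lambda>t. h (x + axis s t)) = 0" for x
  proof -
    have "((\<lambda>t. h (x + axis s t)) has_integral (u (x + axis s L) - u (x + axis s 0))) {0..L}"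
    proof (rule fundamental_theorem_of_calculus)
      fix t assume "t \<in> {0..L}"
      have "((\<lambda>t. u (x + t *\<^sub>R axis s 1)) has_derivative
          (\<lambda>k. grad u (x + t *\<^sub>R axis s 1) \<bullet> (k *\<^sub>R axis s 1))) (at t)"
        by (rule has_derivative_compose[where g=u, OF _ has_derivative_grad[OF diff]])
          (auto intro!: derivative_eq_intros)
      then show "((\<lambda>t. u (x + axis s t)) has_vector_derivative h (x + axis s t)) (at t within {0..L})"
        by - (rule has_vector_derivative_at_within,
          simp add: has_vector_derivative_def h_def inner_axis ax mult_commute_abs)
    qed (use L in auto)
    moreover have "axis s 0 = (0 :: real^'d)"
      by (simp add: vec_eq_iff axis_def)
    ultimately show ?thesis
      using per[of x] by (simp add: integral_unique L_def)
  qed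
  have "continuous_on (cbox (a, 0) (b, L)) (\<lambda>(x, t). h (x + axis s t))"
  proof -
    have "continuous_on (cbox (a, 0) (b, L)) (\<lambda>z. h (fst z + snd z *\<^sub>R axis s 1))"
      by (rule continuous_on_compose2[OF cont]) (auto intro!: continuous_intros)
    then show ?thesis
      by (simp add: case_prod_beta ax)
  qed
  from integral_swap_continuous[OF this]
  have "0 = integral (cbox 0 L) (\<lambda>t. integral (cbox a b) (\<lambda>x. h (x + axis s t)))"
    by (simp only: FTC) simp
  also have "\<dots> = integral (cbox 0 L) (\<lambda>t. integral (cbox a b) h)"
    by (rule integral_cong, rule integral_cbox_periodic_shift[OF cont hper])
      (auto simp: L_def)
  also have "\<dots> = L * integral (cbox a b) h"
    using L by simp
  finally show ?thesis
    using L by (simp add: h_def)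
qed

section \<open>Weighted integrals and orthonormal expansions\<close>

lemma set_integral_product_measure:
  fixes a :: "'a::euclidean_space \<Rightarrow> real" and b :: "'b::euclidean_space \<Rightarrow> real"
  assumes a: "set_integrable lborel A a" and b: "set_integrable lborel B b"
  shows "set_integrable lborel (A \<times> B) (\<lambda>(x, y). a x * b y)"
    and "(LINT (x, y):(A \<times> B)|lborel. a x * b y) = (LINT x:A|lborel. a x) * (LINT y:B|lborel. b y)"
proof -
  let ?a = "\<lambda>x. indicator A x * a x" and ?b = "\<lambda>y. indicator B y * b y"
  have a': "integrable lborel ?a" and b': "integrable lborel ?b"
    using a b by (simp_all add: set_integrable_def)
  have ma: "?a \<in> borel_measurable lborel" and mb: "?b \<in> borel_measurable lborel"
    using a' b' by (auto dest: borel_measurable_integrable)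
  have eq: "(\<lambda>z. indicator (A \<times> B) z *\<^sub>R (case z of (x, y) \<Rightarrow> a x * b y)) = (\<lambda>(x, y). ?a x * ?b y)"
    by (auto simp: fun_eq_iff indicator_def)
  have int: "integrable (lborel \<Otimes>\<^sub>M lborel) (\<lambda>(x, y). ?a x * ?b y)"
  proof (rule lborel_pair.Fubini_integrable)
    have "(\<lambda>x. ?a (fst x) * ?b (snd x)) \<in> borel_measurable (lborel \<Otimes>\<^sub>M lborel)"
      by (intro borel_measurable_times measurable_compose[OF measurable_fst ma]
          measurable_compose[OF measurable_snd mb])
    then show "(\<lambda>(x, y). ?a x * ?b y) \<in> borel_measurable (lborel \<Otimes>\<^sub>M lborel)"
      by (simp add: case_prod_beta)
    have "integrable lborel (\<lambda>x. \<bar>?a x\<bar> * (LINT y|lborel. \<bar>?b y\<bar>))"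
      using integrable_abs[OF a'] by (rule integrable_mult_left)
    then show "integrable lborel (\<lambda>x. LINT y|lborel. norm (case (x, y) of (x, y) \<Rightarrow> ?a x * ?b y))"
      by (simp add: abs_mult mult.assoc)
    show "AE x in lborel. integrable lborel (\<lambda>y. case (x, y) of (x, y) \<Rightarrow> ?a x * ?b y)"
      using b' by (simp add: mult.assoc)
  qed
  show "set_integrable lborel (A \<times> B) (\<lambda>(x, y). a x * b y)"
    unfolding set_integrable_def eq using int by (simp add: lborel_prod)
  have "(LINT (x, y):(A \<times> B)|lborel. a x * b y) = (LINT z|(lborel \<Otimes>\<^sub>M lborel). (case z of (x, y) \<Rightarrow> ?a x * ?b y))"
    unfolding set_lebesgue_integral_def eq by (simp add: lborel_prod)
  also have "\<dots> = (LINT x|lborel. LINT y|lborel. ?a x * ?b y)"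
    using lborel_pair.integral_fst[OF int] by simp
  also have "\<dots> = (LINT x:A|lborel. a x) * (LINT y:B|lborel. b y)"
    by (simp add: set_lebesgue_integral_def del: mult.assoc)
  finally show "(LINT (x, y):(A \<times> B)|lborel. a x * b y) = (LINT x:A|lborel. a x) * (LINT y:B|lborel. b y)" .
qed

lemma set_integral_sum_mult:
  fixes g :: "'i \<Rightarrow> 'a \<Rightarrow> real"
  assumes "\<And>i. i \<in> I \<Longrightarrow> set_integrable M A (g i)"
  shows "set_integrable M A (\<lambda>x. \<Sum>i\<in>I. a i * g i x)"
    and "(LINT x:A|M. (\<Sum>i\<in>I. a i * g i x)) = (\<Sum>i\<in>I. a i * (LINT x:A|M. g i x))"
proof -
  have int: "integrable M (\<lambda>x. a i * (indicator A x * g i x))" if "i \<in> I" for i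
    using assms[OF that] by (simp add: set_integrable_def)
  have eq: "(\<lambda>x. indicator A x *\<^sub>R (\<Sum>i\<in>I. a i * g i x)) = (\<lambda>x. \<Sum>i\<in>I. a i * (indicator A x * g i x))"
    by (simp add: sum_distrib_left mult.left_commute)
  show "set_integrable M A (\<lambda>x. \<Sum>i\<in>I. a i * g i x)"
    unfolding set_integrable_def eq using int by (rule Bochner_Integration.integrable_sum)
  show "(LINT x:A|M. (\<Sum>i\<in>I. a i * g i x)) = (\<Sum>i\<in>I. a i * (LINT x:A|M. g i x))"
    unfolding set_lebesgue_integral_def eq
    by (subst Bochner_Integration.integral_sum) (use int in auto)
qed

lemma set_integrable_weighted_product:
  assumes meas: "set_borel_measurable lborel A w" and nonneg: "\<And>x. x \<in> A \<Longrightarrow> 0 \<le> w x"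
    and a: "in_L2 A w a" and b: "in_L2 A w b"
  shows "set_integrable lborel A (\<lambda>x. w x * (a x * b x))"
proof -
  let ?i = "\<lambda>g x. indicator A x * g x :: real"
  have [measurable]: "?i w \<in> borel_measurable lborel" "?i a \<in> borel_measurable lborel"
      "?i b \<in> borel_measurable lborel"
    using meas a b by (simp_all add: in_L2_def set_borel_measurable_def)
  have "(\<lambda>x. indicator A x *\<^sub>R (w x * (a x * b x))) = (\<lambda>x. ?i w x * (?i a x * ?i b x))"
    by (auto simp: indicator_def fun_eq_iff)
  then have m: "set_borel_measurable lborel A (\<lambda>x. w x * (a x * b x))"
    by (simp only: set_borel_measurable_def) measurable
  show ?thesis
  proof (rule set_integrable_bound[OF _ m])
    show "set_integrable lborel A (\<lambda>x. w x * (a x)\<^sup>2 + w x * (b x)\<^sup>2)"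
      using a b by (intro set_integral_add) (simp_all add: in_L2_def)
    have "norm (w x * (a x * b x)) \<le> norm (w x * (a x)\<^sup>2 + w x * (b x)\<^sup>2)" if "x \<in> A" for x
    proof -
      have "\<bar>a x * b x\<bar> \<le> (a x)\<^sup>2 + (b x)\<^sup>2"
        using sum_squares_bound[of "\<bar>a x\<bar>" "\<bar>b x\<bar>"] mult_nonneg_nonneg[of "\<bar>a x\<bar>" "\<bar>b x\<bar>"]
        unfolding abs_mult power2_abs by linarith
      then have "w x * \<bar>a x * b x\<bar> \<le> w x * ((a x)\<^sup>2 + (b x)\<^sup>2)"
        using nonneg[OF that] by (rule mult_left_mono)
      then show ?thesis
        using nonneg[OF that] by (simp add: abs_mult distrib_left)
    qed
    then show "AE x in lborel. x \<in> A \<longrightarrow> norm (w x * (a x * b x)) \<le> norm (w x * (a x)\<^sup>2 + w x * (b x)\<^sup>2)"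
      by simp
  qed
qed

text \<open>
  The functions are expanded on a set \<open>D\<close> that may be larger than the domain \<open>A\<close> of integration:
  functions of \<open>x\<close> are expanded on the whole space, with inner products over one periodic cell.
\<close>

lemma orthonormal_expansion:
  fixes B :: "nat \<Rightarrow> real^'d \<Rightarrow> real"
  assumes meas: "set_borel_measurable lborel A w" and nonneg: "\<And>x. x \<in> A \<Longrightarrow> 0 \<le> w x"
    and L2: "\<And>i. i \<in> {1..n} \<Longrightarrow> in_L2 A w (B i)"
    and orth: "\<And>i j. i \<in> {1..n} \<Longrightarrow> j \<in> {1..n} \<Longrightarrow>
        (LINT x:A|lborel. w x * (B i x * B j x)) = (if i = j then 1 else 0)"
    and span: "h \<in> fspan D (B ` {1..n})" and "A \<subseteq> D" and "x \<in> D"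
  shows "h x = (\<Sum>k=1..n. B k x * (LINT x:A|lborel. w x * (B k x * h x)))"
proof -
  \<comment> \<open>The span is taken over the set \<open>B ` {1..n}\<close>; orthonormality rules out repeated functions,
    so sums over this set are sums over the index.\<close>
  have inj: "inj_on B {1..n}"
    using orth by (intro inj_onI) (metis zero_neq_one)
  from span obtain a where "\<forall>x\<in>D. h x = (\<Sum>u\<in>B ` {1..n}. a u * u x)"
    unfolding fspan_def by blast
  then have h: "h x = (\<Sum>i=1..n. a (B i) * B i x)" if "x \<in> D" for x
    using that by (simp del: One_nat_def add: sum.reindex[OF inj])
  have "(LINT x:A|lborel. w x * (B k x * h x)) = a (B k)" if k: "k \<in> {1..n}" for k
  proof -
    have "(LINT x:A|lborel. w x * (B k x * h x))
        = (LINT x:A|lborel. (\<Sum>i=1..n. a (B i) * (w x * (B k x * B i x))))"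
      using \<open>A \<subseteq> D\<close> unfolding set_lebesgue_integral_def
      by (intro Bochner_Integration.integral_cong refl)
        (auto simp: h indicator_def sum_distrib_left ac_simps)
    also have "\<dots> = (\<Sum>i=1..n. a (B i) * (LINT x:A|lborel. w x * (B k x * B i x)))"
      using k by (intro set_integral_sum_mult set_integrable_weighted_product[OF meas nonneg] L2) auto
    also have "\<dots> = (\<Sum>i=1..n. if k = i then a (B i) else 0)"
      using k by (intro sum.cong) (auto simp: orth)
    finally show ?thesis
      using k by simp
  qed
  then show ?thesis
    using h[OF \<open>x \<in> D\<close>] by (simp add: mult.commute)
qed

lemma mem_fspan:
  assumes "finite F" "u \<in> F" "\<And>x. x \<in> D \<Longrightarrow> h x = u x"
  shows "h \<in> fspan D F"
proof -
  have "(\<Sum>w\<in>F. (if w = u then 1 else 0) * w x) = u x" for x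
    using assms(1,2) by (simp add: if_distrib[of "\<lambda>z. z * _"] sum.delta cong: if_cong)
  then show ?thesis
    unfolding fspan_def using assms(3) by (auto intro!: exI[of _ "\<lambda>w. if w = u then 1 else 0"])
qed

lemma continuous_in_L2_cbox:
  assumes "continuous_on UNIV h"
  shows "in_L2 (cbox a b) (\<lambda>x. 1) h"
proof -
  have "set_integrable lborel (cbox a b) h" "set_integrable lborel (cbox a b) (\<lambda>x. (h x)\<^sup>2)"
    unfolding set_integrable_def
    by (intro borel_integrable_compact compact_cbox continuous_on_subset[OF assms] subset_UNIV continuous_intros)+
  then show ?thesis
    by (auto simp: in_L2_def set_borel_measurable_def set_integrable_def dest: borel_measurable_integrable)
qed

lemma fspan_sum:
  assumes "\<And>i. i \<in> I \<Longrightarrow> h i \<in> fspan D F"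
  shows "(\<lambda>x. \<Sum>i\<in>I. a i * h i x) \<in> fspan D F"
proof -
  have "\<forall>i\<in>I. \<exists>c. \<forall>x\<in>D. h i x = (\<Sum>u\<in>F. c u * u x)"
    using assms by (auto simp: fspan_def)
  then obtain C where C: "\<And>i x. i \<in> I \<Longrightarrow> x \<in> D \<Longrightarrow> h i x = (\<Sum>u\<in>F. C i u * u x)"
    by metis
  have "(\<Sum>i\<in>I. a i * h i x) = (\<Sum>u\<in>F. (\<Sum>i\<in>I. a i * C i u) * u x)" if "x \<in> D" for x
    using that by (simp add: C sum_distrib_left sum_distrib_right mult.assoc) (rule sum.swap)
  then show ?thesis
    unfolding fspan_def by (intro CollectI exI[of _ "\<lambda>u. \<Sum>i\<in>I. a i * C i u"] ballI)
qed

text \<open>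
  If \<open>p\<close> and \<open>q\<close> hold the inner products of the old with the augmented basis functions, the left-hand
  side is a low-rank sum with projected coefficients, and the right-hand side is the original
  low-rank sum with each basis function replaced by its projection.
\<close>

lemma sum_mult_regroup:
  fixes a b :: "'k \<Rightarrow> real"
  shows "(\<Sum>k\<in>A. \<Sum>l\<in>B. a k * (\<Sum>i\<in>I. \<Sum>j\<in>J. p k i * s i j * q j l) * b l)
       = (\<Sum>i\<in>I. \<Sum>j\<in>J. (\<Sum>k\<in>A. a k * p k i) * s i j * (\<Sum>l\<in>B. b l * q j l))"
proof -
  let ?t = "\<lambda>k l i j. a k * p k i * s i j * (b l * q j l)"
  have "(\<Sum>k\<in>A. \<Sum>l\<in>B. a k * (\<Sum>i\<in>I. \<Sum>j\<in>J. p k i * s i j * q j l) * b l)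
      = (\<Sum>k\<in>A. \<Sum>l\<in>B. \<Sum>i\<in>I. \<Sum>j\<in>J. ?t k l i j)"
    by (simp add: sum_distrib_left sum_distrib_right ac_simps)
  also have "\<dots> = (\<Sum>k\<in>A. \<Sum>i\<in>I. \<Sum>l\<in>B. \<Sum>j\<in>J. ?t k l i j)"
    by (rule sum.cong[OF refl sum.swap])
  also have "\<dots> = (\<Sum>i\<in>I. \<Sum>k\<in>A. \<Sum>l\<in>B. \<Sum>j\<in>J. ?t k l i j)"
    by (rule sum.swap)
  also have "\<dots> = (\<Sum>i\<in>I. \<Sum>k\<in>A. \<Sum>j\<in>J. \<Sum>l\<in>B. ?t k l i j)"
    by (rule sum.cong[OF refl sum.cong[OF refl sum.swap]])
  also have "\<dots> = (\<Sum>i\<in>I. \<Sum>j\<in>J. \<Sum>k\<in>A. \<Sum>l\<in>B. ?t k l i j)"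
    by (rule sum.cong[OF refl sum.swap])
  also have "\<dots> = (\<Sum>i\<in>I. \<Sum>j\<in>J. (\<Sum>k\<in>A. a k * p k i) * s i j * (\<Sum>l\<in>B. b l * q j l))"
    by (intro sum.cong refl) (simp only: sum_product sum_distrib_right[of _ _ "s _ _"])
  finally show ?thesis .
qed

section \<open>Moments of low-rank functions\<close>

context vp_setting
begin

lemma weight_measurable: "set_borel_measurable lborel \<Omega>\<^sub>v f0v"
proof -
  have "(\<lambda>v. indicator \<Omega>\<^sub>v v *\<^sub>R f0v v) \<in> borel_measurable borel"
    by (rule borel_measurable_continuous_on_indicator)
      (use open_\<Omega>\<^sub>v C1_on_imp_continuous_on[OF weight_C1] in auto)
  then show ?thesis
    by (simp add: set_borel_measurable_def)
qed

lemma set_integrable_v: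
  assumes "in_L2 \<Omega>\<^sub>v f0v a" "in_L2 \<Omega>\<^sub>v f0v b"
  shows "set_integrable lborel \<Omega>\<^sub>v (\<lambda>v. f0v v * (a v * b v))"
  by (rule set_integrable_weighted_product[OF weight_measurable _ assms]) (simp add: weight_pos less_imp_le)

lemma one_measurable: "set_borel_measurable lborel \<Omega>\<^sub>x (\<lambda>x. 1 :: real)"
  by (simp add: set_borel_measurable_def \<Omega>\<^sub>x_def)

lemma set_integrable_x:
  assumes "in_L2 \<Omega>\<^sub>x (\<lambda>x. 1) a" "in_L2 \<Omega>\<^sub>x (\<lambda>x. 1) b"
  shows "set_integrable lborel \<Omega>\<^sub>x (\<lambda>x. a x * b x)"
  using set_integrable_weighted_product[OF one_measurable _ assms] by simp

lemma continuous_in_L2_x: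
  assumes "continuous_on UNIV h"
  shows "in_L2 \<Omega>\<^sub>x (\<lambda>x. 1) h"
  using continuous_in_L2_cbox[OF assms] by (simp add: \<Omega>\<^sub>x_def)

lemma expansion_x:
  assumes "orthonormal_x n B" "h \<in> fspan UNIV (B ` {1..n})"
  shows "(\<Sum>k=1..n. B k x * ip_x (B k) h) = h x"
proof -
  have "h x = (\<Sum>k=1..n. B k x * (LINT x:\<Omega>\<^sub>x|lborel. 1 * (B k x * h x)))"
    by (rule orthonormal_expansion[OF one_measurable _ _ _ assms(2)])
      (use assms(1) in \<open>simp_all add: orthonormal_x_def ip_x_def\<close>)
  then show ?thesis
    by (simp add: ip_x_def)
qed

lemma expansion_v:
  assumes "orthonormal_v n B" "h \<in> fspan \<Omega>\<^sub>v (B ` {1..n})" "v \<in> \<Omega>\<^sub>v"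
  shows "(\<Sum>k=1..n. B k v * ip_v (B k) h) = h v"
proof -
  have "h v = (\<Sum>k=1..n. B k v * (LINT w:\<Omega>\<^sub>v|lborel. f0v w * (B k w * h w)))"
    by (rule orthonormal_expansion[OF weight_measurable _ _ _ assms(2)])
      (use assms(1,3) in \<open>simp_all add: orthonormal_v_def ip_v_def weight_pos less_imp_le\<close>)
  then show ?thesis
    by (simp add: ip_v_def)
qed

lemma ip_v_commute: "ip_v a b = ip_v b a"
  by (simp add: ip_v_def mult.commute)

lemma ip_v_cong: "(\<And>v. v \<in> \<Omega>\<^sub>v \<Longrightarrow> a v = a' v) \<Longrightarrow> (\<And>v. v \<in> \<Omega>\<^sub>v \<Longrightarrow> b v = b' v) \<Longrightarrow> ip_v a b = ip_v a' b'"
  unfolding ip_v_def set_lebesgue_integral_def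
  by (intro Bochner_Integration.integral_cong) (auto simp: indicator_def)

text \<open>
  As \<open>V 1\<close> is the normalised constant, the integral of \<open>f0v\<close> times \<open>V j\<close> is the norm of the constant
  function times the inner product of \<open>V 1\<close> and \<open>V j\<close>.
\<close>

lemma moments_orthonormal_v:
  assumes V: "orthonormal_v n V" and n: "1 \<le> n" and V1: "\<forall>v\<in>\<Omega>\<^sub>v. V 1 v = U 1 v"
  shows "norm_v (\<lambda>w. 1) \<noteq> 0"
    and "j \<in> {1..n} \<Longrightarrow> set_integrable lborel \<Omega>\<^sub>v (\<lambda>v. f0v v * V j v)"
    and "j \<in> {1..n} \<Longrightarrow> (LINT v:\<Omega>\<^sub>v|lborel. f0v v * V j v) = (if j = 1 then norm_v (\<lambda>w. 1) else 0)"
proof -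
  let ?n = "norm_v (\<lambda>w. 1)"
  have ip: "ip_v (U 1) (V j) = (if j = 1 then 1 else 0)" if "j \<in> {1..n}" for j
    using V n that ip_v_cong[of "V 1" "U 1" "V j" "V j"] V1 by (auto simp: orthonormal_v_def)
  \<comment> \<open>Were the norm zero, \<open>U 1\<close> would be the zero function by the convention for division by zero,
    contradicting its normalisation.\<close>
  have ip': "ip_v (U 1) (V j) = (LINT v:\<Omega>\<^sub>v|lborel. f0v v * V j v) / ?n" for j
    by (simp add: ip_v_def U_def)
  show n0: "?n \<noteq> 0"
    using ip[of 1] ip'[of 1] n by auto
  show "set_integrable lborel \<Omega>\<^sub>v (\<lambda>v. f0v v * V j v)" if "j \<in> {1..n}"
    using set_integrable_v[OF weight_L2_1, of "V j"] V that by (simp add: orthonormal_v_def)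
  show "(LINT v:\<Omega>\<^sub>v|lborel. f0v v * V j v) = (if j = 1 then ?n else 0)" if "j \<in> {1..n}"
    using ip[OF that] ip'[of j] n0 by (auto simp: field_simps split: if_splits)
qed

lemma lowrank_eq: "lowrank r X S V x v = (\<Sum>j=1..r. K_old r X S j x * (f0v v * V j v))"
proof -
  have "lowrank r X S V x v = (\<Sum>i=1..r. \<Sum>j=1..r. X i x * S i j * (f0v v * V j v))"
    by (simp add: lowrank_def sum_distrib_left ac_simps)
  also have "\<dots> = (\<Sum>j=1..r. \<Sum>i=1..r. X i x * S i j * (f0v v * V j v))"
    by (rule sum.swap)
  finally show ?thesis
    by (simp add: K_old_def sum_distrib_right)
qed

lemma density_mass_lowrank:
  assumes r: "1 \<le> r"
    and int: "\<And>j. j \<in> {1..r} \<Longrightarrow> set_integrable lborel \<Omega>\<^sub>v (\<lambda>v. f0v v * V j v)"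
    and mom: "\<And>j. j \<in> {1..r} \<Longrightarrow> (LINT v:\<Omega>\<^sub>v|lborel. f0v v * V j v) = (if j = 1 then n else 0)"
  shows "density (lowrank r X S V) x = K_old r X S 1 x * n"
    and "orthonormal_x r X \<Longrightarrow> mass (lowrank r X S V) = (LINT x:\<Omega>\<^sub>x|lborel. K_old r X S 1 x) * n"
proof -
  have "density (lowrank r X S V) x = (\<Sum>j=1..r. K_old r X S j x * (LINT v:\<Omega>\<^sub>v|lborel. f0v v * V j v))"
    unfolding density_def lowrank_eq using int by (rule set_integral_sum_mult)
  also have "\<dots> = (\<Sum>j=1..r. if j = 1 then K_old r X S j x * n else 0)"
    by (intro sum.cong) (auto simp: mom)
  finally show "density (lowrank r X S V) x = K_old r X S 1 x * n"
    using r by simp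
next
  assume X: "orthonormal_x r X"
  have intX: "set_integrable lborel \<Omega>\<^sub>x (X i)" if "i \<in> {1..r}" for i
    using set_integrable_x[OF continuous_in_L2_x[of "\<lambda>x. 1"], of "X i"] X that
    by (simp add: orthonormal_x_def)
  have intK: "set_integrable lborel \<Omega>\<^sub>x (K_old r X S j)" for j
    using set_integral_sum_mult(1)[of "{1..r}" lborel \<Omega>\<^sub>x X "\<lambda>i. S i j"] intX
    by (simp add: K_old_def[abs_def] mult.commute)
  have "(\<lambda>(x, v). lowrank r X S V x v)
      = (\<lambda>z. \<Sum>j=1..r. 1 * (case z of (x, v) \<Rightarrow> K_old r X S j x * (f0v v * V j v)))"
    by (auto simp: fun_eq_iff lowrank_eq)
  then have "mass (lowrank r X S V)
      = (LINT z:(\<Omega>\<^sub>x \<times> \<Omega>\<^sub>v)|lborel. (\<Sum>j=1..r. 1 * (case z of (x, v) \<Rightarrow> K_old r X S j x * (f0v v * V j v))))"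
    by (simp only: mass_def)
  also have "\<dots> = (\<Sum>j=1..r. 1 * (LINT z:(\<Omega>\<^sub>x \<times> \<Omega>\<^sub>v)|lborel. (case z of (x, v) \<Rightarrow> K_old r X S j x * (f0v v * V j v))))"
    by (intro set_integral_sum_mult set_integral_product_measure intK int)
  also have "\<dots> = (\<Sum>j=1..r. (LINT x:\<Omega>\<^sub>x|lborel. K_old r X S j x) * (LINT v:\<Omega>\<^sub>v|lborel. f0v v * V j v))"
    by (simp add: set_integral_product_measure(2)[OF intK int])
  also have "\<dots> = (\<Sum>j=1..r. if j = 1 then (LINT x:\<Omega>\<^sub>x|lborel. K_old r X S j x) * n else 0)"
    by (intro sum.cong) (auto simp: mom)
  finally show "mass (lowrank r X S V) = (LINT x:\<Omega>\<^sub>x|lborel. K_old r X S 1 x) * n"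
    using r by simp
qed

section \<open>The projected function and its coefficients\<close>

text \<open>
  Agreement on the velocity domain suffices: functions with equal densities have the same potentials,
  so the same one is chosen for both, and gradients on an open set are local.
\<close>

lemma RHS_cong:
  assumes eq: "\<And>x v. v \<in> \<Omega>\<^sub>v \<Longrightarrow> g x v = f x v" and v: "v \<in> \<Omega>\<^sub>v"
  shows "RHS g x v = RHS f x v"
proof -
  have "density g = density f"
    unfolding density_def set_lebesgue_integral_def
    by (intro ext Bochner_Integration.integral_cong) (auto simp: eq indicator_def)
  then have "efield g = efield f"
    by (simp add: fun_eq_iff efield_def is_potential_def)
  moreover have "grad (g x) v = grad (f x) v"
    using open_\<Omega>\<^sub>v v eq by (rule grad_cong_open)
  moreover have "(\<lambda>y. g y v) = (\<lambda>y. f y v)"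
    using eq v by blast
  ultimately show ?thesis
    by (simp add: RHS_def)
qed

lemma f_proj_eq_lowrank:
  assumes Xt: "orthonormal_x Nx Xt" and Vt: "orthonormal_v Nv Vt"
    and X: "\<And>i. i \<in> {1..r} \<Longrightarrow> X i \<in> fspan UNIV (Xt ` {1..Nx})"
    and V: "\<And>j. j \<in> {1..r} \<Longrightarrow> V j \<in> fspan \<Omega>\<^sub>v (Vt ` {1..Nv})"
    and v: "v \<in> \<Omega>\<^sub>v"
  shows "f_proj r X S V Nx Xt Nv Vt x v = lowrank r X S V x v"
proof -
  have "f_proj r X S V Nx Xt Nv Vt x v = f0v v *
      (\<Sum>i=1..r. \<Sum>j=1..r. (\<Sum>k=1..Nx. Xt k x * ip_x (Xt k) (X i)) * S i j * (\<Sum>l=1..Nv. Vt l v * ip_v (V j) (Vt l)))"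
    by (simp only: f_proj_def S_proj_def sum_mult_regroup)
  also have "\<dots> = f0v v * (\<Sum>i=1..r. \<Sum>j=1..r. X i x * S i j * V j v)"
    using expansion_x[OF Xt X] expansion_v[OF Vt V v]
    by (intro arg_cong2[where f="(*)"] sum.cong refl) (simp_all only: ip_v_commute[of "V _"])
  finally show ?thesis
    by (simp add: lowrank_def)
qed

lemma S_proj_first_column:
  assumes Xt: "orthonormal_x Nx Xt" and V: "orthonormal_v r V" and r: "1 \<le> r"
    and X: "\<And>i. i \<in> {1..r} \<Longrightarrow> X i \<in> fspan UNIV (Xt ` {1..Nx})"
    and Vt1: "\<And>v. v \<in> \<Omega>\<^sub>v \<Longrightarrow> Vt 1 v = V 1 v"
  shows "(\<Sum>k=1..Nx. Xt k x * S_proj r X S V Xt Vt k 1) = K_old r X S 1 x"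
proof -
  have "ip_v (V j) (Vt 1) = (if j = 1 then 1 else 0)" if "j \<in> {1..r}" for j
    using ip_v_cong[of "V j" "V j" "Vt 1" "V 1"] Vt1 V r that by (auto simp: orthonormal_v_def)
  then have "S_proj r X S V Xt Vt k 1 = (\<Sum>i=1..r. \<Sum>j=1..r. if j = 1 then ip_x (Xt k) (X i) * S i j else 0)" for k
    unfolding S_proj_def by (intro sum.cong refl) auto
  then have "S_proj r X S V Xt Vt k 1 = (\<Sum>i=1..r. ip_x (Xt k) (X i) * S i 1)" for k
    using r by simp
  then have "(\<Sum>k=1..Nx. Xt k x * S_proj r X S V Xt Vt k 1)
      = (\<Sum>k=1..Nx. \<Sum>i=1..r. Xt k x * ip_x (Xt k) (X i) * S i 1)"
    by (simp add: sum_distrib_left mult.assoc)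
  also have "\<dots> = (\<Sum>i=1..r. (\<Sum>k=1..Nx. Xt k x * ip_x (Xt k) (X i)) * S i 1)"
    by (subst sum.swap) (simp add: sum_distrib_right)
  also have "\<dots> = K_old r X S 1 x"
    using expansion_x[OF Xt X] by (simp add: K_old_def)
  finally show ?thesis .
qed

text \<open>
  The truncation acts only on the columns after the first \<open>m\<close>: the first coefficient function
  is that of the untruncated matrix, and the velocity functions after the first \<open>m\<close> are combinations of the
  augmented functions after the first \<open>m\<close>, hence orthogonal to the fixed ones if the augmented basis is
  orthonormal and starts with them.
\<close>

lemma truncation_first_column:
  assumes trunc: "truncation r m Nx Xt Nv Vt St X' S' V'" and m: "1 \<le> m" "m \<le> r"
  obtains Q where "orthonormal_x r X'"
    and "\<And>x. K_old r X' S' 1 x = (\<Sum>k=1..Nx. Xt k x * St k 1)"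
    and "\<And>a v. a \<in> {1..m} \<Longrightarrow> v \<in> \<Omega>\<^sub>v \<Longrightarrow> V' a v = U a v"
    and "\<And>j v. j \<in> {1..r-m} \<Longrightarrow> v \<in> \<Omega>\<^sub>v \<Longrightarrow> V' (m + j) v = (\<Sum>i=1..Nv-m. Vt (m + i) v * Q i j)"
proof -
  from trunc obtain Xc Sc Xr Sr P \<sigma> Q R where
    Kt: "is_qr m (\<lambda>l x. \<Sum>k=1..Nx. Xt k x * St k l) Xc Sc"
    and U': "\<forall>a\<in>{1..m}. \<forall>v\<in>\<Omega>\<^sub>v. V' a v = U a v"
    and W': "\<forall>j\<in>{1..r-m}. \<forall>v\<in>\<Omega>\<^sub>v. V' (m + j) v = (\<Sum>i=1..Nv-m. Vt (m + i) v * Q i j)"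
    and Y: "is_qr r (\<lambda>j x. if j \<le> m then Xc j x else (\<Sum>i=1..Nv-m. Xr i x * P i (j - m))) X' R"
    and S': "\<forall>i\<in>{1..r}. \<forall>j\<in>{1..r}. S' i j = (\<Sum>k=1..r. R i k *
       (if k \<le> m \<and> j \<le> m then Sc k j else if m < k \<and> k = j then \<sigma> (k - m) else 0))"
    unfolding truncation_def Let_def by blast
  have K: "K_old r X' S' 1 x = (\<Sum>k=1..Nx. Xt k x * St k 1)" for x
  proof -
    have Y': "(\<Sum>i=1..r. X' i x * R i k) = (if k \<le> m then Xc k x else (\<Sum>i=1..Nv-m. Xr i x * P i (k - m)))"
      if "k \<in> {1..r}" for k
    proof -
      have "\<forall>j\<in>{1..r}. \<forall>x. (if j \<le> m then Xc j x else (\<Sum>i=1..Nv-m. Xr i x * P i (j - m)))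
          = (\<Sum>i=1..r. X' i x * R i j)"
        using Y unfolding is_qr_def by (elim conjE)
      from spec[OF bspec[OF this that]] show ?thesis
        by (rule sym)
    qed
    let ?b = "\<lambda>k. if k \<le> m then Sc k 1 else 0"
    have "S' i 1 = (\<Sum>k=1..r. R i k * ?b k)" if "i \<in> {1..r}" for i
      using that m S' by (auto intro!: sum.cong)
    then have "K_old r X' S' 1 x = (\<Sum>i=1..r. \<Sum>k=1..r. X' i x * R i k * ?b k)"
      by (simp add: K_old_def sum_distrib_left mult.assoc)
    also have "\<dots> = (\<Sum>k=1..r. (\<Sum>i=1..r. X' i x * R i k) * ?b k)"
      by (subst sum.swap) (simp add: sum_distrib_right)
    also have "\<dots> = (\<Sum>k=1..r. if k \<le> m then Xc k x * Sc k 1 else 0)"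
      using Y' by (intro sum.cong refl) simp
    also have "\<dots> = (\<Sum>k=1..m. Xc k x * Sc k 1)"
      using m by (intro sum.mono_neutral_cong_right) auto
    also have "\<dots> = (\<Sum>k=1..Nx. Xt k x * St k 1)"
      using Kt m by (auto simp: is_qr_def)
    finally show ?thesis .
  qed
  show ?thesis
  proof (rule that[of Q])
    show "orthonormal_x r X'"
      using Y unfolding is_qr_def by blast
  qed (use K U' W' in blast)+
qed

section \<open>Flux and right-hand side of a low-rank function\<close>

lemma set_integral_cong_v:
  assumes "\<And>v. v \<in> \<Omega>\<^sub>v \<Longrightarrow> g v = (h v :: real)"
  shows "set_integrable lborel \<Omega>\<^sub>v g = set_integrable lborel \<Omega>\<^sub>v h"
    and "(LINT v:\<Omega>\<^sub>v|lborel. g v) = (LINT v:\<Omega>\<^sub>v|lborel. h v)"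
proof -
  have "(\<lambda>v. indicator \<Omega>\<^sub>v v *\<^sub>R g v) = (\<lambda>v. indicator \<Omega>\<^sub>v v *\<^sub>R h v)"
    using assms by (auto simp: indicator_def)
  then show "set_integrable lborel \<Omega>\<^sub>v g = set_integrable lborel \<Omega>\<^sub>v h"
    and "(LINT v:\<Omega>\<^sub>v|lborel. g v) = (LINT v:\<Omega>\<^sub>v|lborel. h v)"
    by (simp_all add: set_integrable_def set_lebesgue_integral_def)
qed

lemma grad_K_old:
  assumes "\<And>i. i \<in> {1..r} \<Longrightarrow> C1_on UNIV (X i)"
  shows "grad (K_old r X S j) x = (\<Sum>i=1..r. S i j *\<^sub>R grad (X i) x)"
proof -
  have "K_old r X S j = (\<lambda>x. \<Sum>i=1..r. S i j * X i x)"
    by (simp add: K_old_def fun_eq_iff mult.commute)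
  then show ?thesis
    using assms by (simp only: C1_on_def UNIV_I ball_simps simp_thms) (rule grad_sum_mult, blast)
qed

lemma C1_on_K_old:
  assumes X: "\<And>i. i \<in> {1..r} \<Longrightarrow> C1_on UNIV (X i)"
  shows "C1_on UNIV (K_old r X S j)"
proof -
  have "grad (K_old r X S j) = (\<lambda>x. \<Sum>i=1..r. S i j *\<^sub>R grad (X i) x)"
    using grad_K_old[where X=X and r=r, OF X] by blast
  moreover have "continuous_on UNIV (\<lambda>x. \<Sum>i=1..r. S i j *\<^sub>R grad (X i) x)"
    using X by (intro continuous_intros) (simp add: C1_on_def)
  moreover have "K_old r X S j differentiable (at x)" for x
    unfolding K_old_def[abs_def]
    using X by (intro differentiable_sum differentiable_mult finite_atLeastAtMost differentiable_const)
      (simp add: C1_on_def)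
  ultimately show ?thesis
    by (simp add: C1_on_def)
qed

text \<open>
  Sums over a velocity index and a coordinate direction are written as sums over pairs.
\<close>

lemma divergence_current:
  assumes X: "\<And>i. i \<in> {1..r} \<Longrightarrow> C1_on UNIV (X i)"
    and V: "\<And>j s. j \<in> {1..r} \<Longrightarrow> in_L2 \<Omega>\<^sub>v f0v (\<lambda>v. v $ s * V j v)"
  shows "divergence (current (lowrank r X S V)) x
    = (\<Sum>p\<in>{1..r} \<times> UNIV. ip_v (\<lambda>v. 1) (\<lambda>v. v $ snd p * V (fst p) v) * grad (K_old r X S (fst p)) x $ snd p)"
proof -
  define f where "f = lowrank r X S V"
  let ?K = "K_old r X S"
  let ?q = "\<lambda>s j v. f0v v * (1 * (v $ s * V j v))"
  let ?\<kappa> = "\<lambda>s j. LINT v:\<Omega>\<^sub>v|lborel. ?q s j v"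
  have q: "set_integrable lborel \<Omega>\<^sub>v (?q s j)" if "j \<in> {1..r}" for s j
    using set_integrable_v[OF weight_L2_1 V[OF that, of s]] .
  have fs: "f y v * v $ s = (\<Sum>j=1..r. ?K j y * ?q s j v)" for y v s
    by (simp add: f_def lowrank_eq sum_distrib_left sum_distrib_right ac_simps)
  have f_int: "set_integrable lborel \<Omega>\<^sub>v (\<lambda>v. f y v * v $ s)" for y s
    unfolding fs by (rule set_integral_sum_mult) (rule q)
  have "current f y $ s = (\<Sum>j=1..r. ?\<kappa> s j * ?K j y)" for y s
  proof -
    have eq: "(\<lambda>v. indicator \<Omega>\<^sub>v v *\<^sub>R (f y v *\<^sub>R v))
        = (\<lambda>v. \<Sum>s\<in>UNIV. (indicator \<Omega>\<^sub>v v *\<^sub>R (f y v * v $ s)) *\<^sub>R axis s 1)"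
      by (rule ext) (simp add: vec_eq_iff axis_def if_distrib cong: if_cong)
    have "integrable lborel (\<lambda>v. indicator \<Omega>\<^sub>v v *\<^sub>R (f y v *\<^sub>R v))"
      unfolding eq using f_int
      by (intro Bochner_Integration.integrable_sum integrable_scaleR_left) (simp add: set_integrable_def)
    from integral_bounded_linear[OF bounded_linear_vec_nth this, of s, symmetric]
    have "current f y $ s = (LINT v:\<Omega>\<^sub>v|lborel. f y v * v $ s)"
      by (simp add: current_def set_lebesgue_integral_def mult.assoc)
    also have "\<dots> = (\<Sum>j=1..r. ?K j y * ?\<kappa> s j)"
      unfolding fs by (rule set_integral_sum_mult) (rule q)
    finally show ?thesis
      by (simp add: mult.commute)
  qed
  then have "grad (\<lambda>y. current f y $ s) x = grad (\<lambda>y. \<Sum>j=1..r. ?\<kappa> s j * ?K j y) x" for s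
    by presburger
  also have "\<dots> s = (\<Sum>j=1..r. ?\<kappa> s j *\<^sub>R grad (?K j) x)" for s
    using C1_on_K_old[where X=X and r=r, OF X] by (intro grad_sum_mult) (simp add: C1_on_def)
  finally have "grad (\<lambda>y. current f y $ s) x = (\<Sum>j=1..r. ?\<kappa> s j *\<^sub>R grad (?K j) x)" for s .
  then have "divergence (current f) x = (\<Sum>s\<in>UNIV. \<Sum>j=1..r. ?\<kappa> s j * grad (?K j) x $ s)"
    by (simp add: divergence_def)
  also have "\<dots> = (\<Sum>j=1..r. \<Sum>s\<in>UNIV. ?\<kappa> s j * grad (?K j) x $ s)"
    by (rule sum.swap)
  finally show ?thesis
    by (simp add: f_def ip_v_def sum.cartesian_product case_prod_beta)
qed

lemma RHS_lowrank:
  assumes X: "\<And>i. i \<in> {1..r} \<Longrightarrow> C1_on UNIV (X i)"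
    and V: "\<And>j. j \<in> {1..r} \<Longrightarrow> C1_on \<Omega>\<^sub>v (V j)"
    and v: "v \<in> \<Omega>\<^sub>v"
  shows "RHS (lowrank r X S V) x v
    = - (\<Sum>p\<in>{1..r} \<times> UNIV. grad (K_old r X S (fst p)) x $ snd p * (f0v v * (v $ snd p * V (fst p) v)))
      + (\<Sum>p\<in>{1..r} \<times> UNIV. efield (lowrank r X S V) x $ snd p * K_old r X S (fst p) x
            * grad (\<lambda>w. f0v w * V (fst p) w) v $ snd p)"
proof -
  let ?f = "lowrank r X S V" and ?K = "K_old r X S"
  have "grad (\<lambda>y. ?f y v) x = grad (\<lambda>y. \<Sum>j=1..r. (f0v v * V j v) * ?K j y) x"
    by (simp add: lowrank_eq mult.commute)
  also have "\<dots> = (\<Sum>j=1..r. (f0v v * V j v) *\<^sub>R grad (?K j) x)"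
    using C1_on_K_old[where X=X and r=r, OF X] by (intro grad_sum_mult) (simp add: C1_on_def)
  finally have "v \<bullet> grad (\<lambda>y. ?f y v) x = (\<Sum>j=1..r. (f0v v * V j v) * (v \<bullet> grad (?K j) x))"
    by (simp add: inner_sum_right)
  then have transport: "v \<bullet> grad (\<lambda>y. ?f y v) x = (\<Sum>j=1..r. \<Sum>s\<in>UNIV. grad (?K j) x $ s * (f0v v * (v $ s * V j v)))"
    by (simp add: inner_vec_def sum_distrib_left ac_simps)
  have "?f x = (\<lambda>w. \<Sum>j=1..r. ?K j x * (f0v w * V j w))"
    by (simp add: lowrank_eq fun_eq_iff)
  then have "grad (?f x) v = grad (\<lambda>w. \<Sum>j=1..r. ?K j x * (f0v w * V j w)) v"
    by simp
  also have "\<dots> = (\<Sum>j=1..r. ?K j x *\<^sub>R grad (\<lambda>w. f0v w * V j w) v)"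
    using V weight_C1 v by (intro grad_sum_mult differentiable_mult) (auto simp: C1_on_def)
  finally have "efield ?f x \<bullet> grad (?f x) v
      = (\<Sum>j=1..r. ?K j x * (efield ?f x \<bullet> grad (\<lambda>w. f0v w * V j w) v))"
    by (simp add: inner_sum_right)
  then have "efield ?f x \<bullet> grad (?f x) v
      = (\<Sum>j=1..r. \<Sum>s\<in>UNIV. efield ?f x $ s * ?K j x * grad (\<lambda>w. f0v w * V j w) v $ s)"
    by (simp add: inner_vec_def sum_distrib_left ac_simps)
  with transport show ?thesis
    by (simp add: RHS_def sum.cartesian_product case_prod_beta)
qed

text \<open>
  Testing with a function of \<open>x\<close> times the constant \<open>V 1\<close> removes the force term, by integration by
  parts in \<open>v\<close>; only the transport term remains.
\<close>

lemma pair_xv_RHS: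
  assumes st: "lowrank_state r m X S V" and m: "1 \<le> m"
    and a: "in_L2 \<Omega>\<^sub>x (\<lambda>x. 1) a"
  shows "pair_xv (\<lambda>x v. a x * V 1 v) (RHS (lowrank r X S V))
    = - (\<Sum>p\<in>{1..r} \<times> UNIV. ip_x a (\<lambda>x. grad (K_old r X S (fst p)) x $ snd p)
            * ip_v (V 1) (\<lambda>v. v $ snd p * V (fst p) v))"
proof -
  let ?f = "lowrank r X S V" and ?K = "K_old r X S" and ?P = "{1..r} \<times> (UNIV :: 'd set)"
  from st m have r: "1 \<in> {1..r}"
    and X: "\<And>i. i \<in> {1..r} \<Longrightarrow> C1_on UNIV (X i)"
    and V: "\<And>j. j \<in> {1..r} \<Longrightarrow> C1_on \<Omega>\<^sub>v (V j)"
    and V_orth: "orthonormal_v r V"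
    and vV: "\<And>j s. j \<in> {1..r} \<Longrightarrow> in_L2 \<Omega>\<^sub>v f0v (\<lambda>v. v $ s * V j v)"
    and V1: "\<And>v. v \<in> \<Omega>\<^sub>v \<Longrightarrow> V 1 v = U 1 v"
    and parts_int: "\<And>j s. j \<in> {1..r} \<Longrightarrow>
        set_integrable lborel \<Omega>\<^sub>v (\<lambda>v. V 1 v * grad (\<lambda>w. f0v w * V j w) v $ s)"
    and parts: "\<And>j s. j \<in> {1..r} \<Longrightarrow>
        (LINT v:\<Omega>\<^sub>v|lborel. V 1 v * grad (\<lambda>w. f0v w * V j w) v $ s)
          = - (LINT v:\<Omega>\<^sub>v|lborel. grad (V 1) v $ s * (f0v v * V j v))"
    and pot: "\<exists>\<phi>. is_potential ?f \<phi>"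
    unfolding lowrank_state_def by auto
  \<comment> \<open>Transport (\<open>a1\<close>, \<open>b1\<close>) and force (\<open>a2\<close>, \<open>b2\<close>) contributions, separated into factors
    depending on \<open>x\<close> and on \<open>v\<close>.\<close>
  define a1 where "a1 = (\<lambda>p x. a x * grad (?K (fst p)) x $ snd p)"
  define b1 where "b1 = (\<lambda>p v. f0v v * (V 1 v * (v $ snd p * V (fst p) v)))"
  define a2 where "a2 = (\<lambda>p x. a x * (efield ?f x $ snd p * ?K (fst p) x))"
  define b2 where "b2 = (\<lambda>p v. V 1 v * grad (\<lambda>w. f0v w * V (fst p) w) v $ snd p)"
  have KC1: "C1_on UNIV (?K j)" for j
    using C1_on_K_old[where X=X and r=r, OF X] .
  have a1: "set_integrable lborel \<Omega>\<^sub>x (a1 p)" for p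
    unfolding a1_def using KC1
    by (intro set_integrable_x a continuous_in_L2_x continuous_intros) (simp add: C1_on_def)
  have b1: "set_integrable lborel \<Omega>\<^sub>v (b1 p)" if "p \<in> ?P" for p
    unfolding b1_def using V_orth r that by (intro set_integrable_v vV) (auto simp: orthonormal_v_def)
  define \<phi> where "\<phi> = (SOME \<phi>. is_potential ?f \<phi>)"
  have "is_potential ?f \<phi>"
    unfolding \<phi>_def using pot by (rule someI_ex)
  then have "continuous_on UNIV (grad \<phi>)"
    unfolding is_potential_def C1_on_def by blast
  then have E: "continuous_on UNIV (efield ?f)"
    unfolding efield_def[abs_def] \<phi>_def[symmetric] by (intro continuous_intros)
  have a2: "set_integrable lborel \<Omega>\<^sub>x (a2 p)" for p
    unfolding a2_def using E C1_on_imp_continuous_on[OF KC1]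
    by (intro set_integrable_x a continuous_in_L2_x continuous_intros) simp_all
  have b2: "set_integrable lborel \<Omega>\<^sub>v (b2 p)" if "p \<in> ?P" for p
    unfolding b2_def using that by (intro parts_int) auto
  have grad_V1: "grad (V 1) v = 0" if "v \<in> \<Omega>\<^sub>v" for v
    using grad_cong_open[OF open_\<Omega>\<^sub>v that, of "V 1" "\<lambda>v. 1 / norm_v (\<lambda>w. 1)"] V1
    by (simp add: U_def)
  have b2_0: "(LINT v:\<Omega>\<^sub>v|lborel. b2 p v) = 0" if "p \<in> ?P" for p
  proof -
    have "(LINT v:\<Omega>\<^sub>v|lborel. grad (V 1) v $ snd p * (f0v v * V (fst p) v)) = (LINT v:\<Omega>\<^sub>v|lborel. 0)"
      by (rule set_integral_cong_v) (simp add: grad_V1 del: One_nat_def)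
    then show ?thesis
      using that by (auto simp: b2_def parts simp del: One_nat_def)
  qed
  have ind: "indicator (\<Omega>\<^sub>x \<times> \<Omega>\<^sub>v) z *\<^sub>R (case z of (x, v) \<Rightarrow> a x * V 1 v * RHS ?f x v)
      = indicator (\<Omega>\<^sub>x \<times> \<Omega>\<^sub>v) z *\<^sub>R ((\<Sum>p\<in>?P. (-1) * (case z of (x, v) \<Rightarrow> a1 p x * b1 p v))
          + (\<Sum>p\<in>?P. 1 * (case z of (x, v) \<Rightarrow> a2 p x * b2 p v)))" for z
  proof (cases "z \<in> \<Omega>\<^sub>x \<times> \<Omega>\<^sub>v")
    case True
    then obtain x v where z: "z = (x, v)" "v \<in> \<Omega>\<^sub>v" by auto
    have "a x * V 1 v * RHS ?f x v
        = - (\<Sum>p\<in>?P. a1 p x * b1 p v) + (\<Sum>p\<in>?P. a2 p x * b2 p v)"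
    proof -
      have "RHS ?f x v = - (\<Sum>p\<in>?P. grad (?K (fst p)) x $ snd p * (f0v v * (v $ snd p * V (fst p) v)))
          + (\<Sum>p\<in>?P. efield ?f x $ snd p * ?K (fst p) x * grad (\<lambda>w. f0v w * V (fst p) w) v $ snd p)"
        using X V z(2) by (rule RHS_lowrank)
      then show ?thesis
        by (simp only: a1_def a2_def b1_def b2_def distrib_left mult_minus_right sum_distrib_left ac_simps)
    qed
    then show ?thesis
      by (simp add: z(1) sum_negf)
  qed simp
  have "pair_xv (\<lambda>x v. a x * V 1 v) (RHS ?f)
      = (LINT z:(\<Omega>\<^sub>x \<times> \<Omega>\<^sub>v)|lborel. (\<Sum>p\<in>?P. (-1) * (case z of (x, v) \<Rightarrow> a1 p x * b1 p v))
          + (\<Sum>p\<in>?P. 1 * (case z of (x, v) \<Rightarrow> a2 p x * b2 p v)))"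
    by (simp only: pair_xv_def set_lebesgue_integral_def ind)
  also have "\<dots> = (\<Sum>p\<in>?P. (-1) * (LINT z:(\<Omega>\<^sub>x \<times> \<Omega>\<^sub>v)|lborel. (case z of (x, v) \<Rightarrow> a1 p x * b1 p v)))
          + (\<Sum>p\<in>?P. 1 * (LINT z:(\<Omega>\<^sub>x \<times> \<Omega>\<^sub>v)|lborel. (case z of (x, v) \<Rightarrow> a2 p x * b2 p v)))"
    by (subst set_integral_add(2))
      (intro set_integral_sum_mult set_integral_product_measure a1 a2 b1 b2
        arg_cong2[where f="(+)"]; assumption)+
  also have "\<dots> = (\<Sum>p\<in>?P. (-1) * ((LINT x:\<Omega>\<^sub>x|lborel. a1 p x) * (LINT v:\<Omega>\<^sub>v|lborel. b1 p v)))
          + (\<Sum>p\<in>?P. 1 * ((LINT x:\<Omega>\<^sub>x|lborel. a2 p x) * (LINT v:\<Omega>\<^sub>v|lborel. b2 p v)))"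
    by (intro arg_cong2[where f="(+)"] sum.cong refl arg_cong2[where f="(*)"]
        set_integral_product_measure(2) a1 a2 b1 b2)
  also have "(\<Sum>p\<in>?P. 1 * ((LINT x:\<Omega>\<^sub>x|lborel. a2 p x) * (LINT v:\<Omega>\<^sub>v|lborel. b2 p v))) = 0"
    by (intro sum.neutral ballI) (simp only: b2_0 mult_zero_right)
  finally show ?thesis
    by (simp add: a1_def b1_def ip_x_def ip_v_def sum_negf)
qed

section \<open>One step of the integrator\<close>

text \<open>
  The effect of one step on the first coefficient function, together with what is needed to evaluate
  the density and mass of the new function.
\<close>

lemma dlr_step_first_coefficient:
  assumes st: "lowrank_state r m X S V" and m: "1 \<le> m"
    and step: "dlr_step \<tau> r m X S V X' S' V'"
  shows "K_old r X' S' 1 x = K_old r X S 1 x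
      - \<tau> * (\<Sum>p\<in>{1..r} \<times> UNIV. ip_v (V 1) (\<lambda>v. v $ snd p * V (fst p) v) * grad (K_old r X S (fst p)) x $ snd p)"
    and "orthonormal_x r X'"
    and "j \<in> {1..r} \<Longrightarrow> set_integrable lborel \<Omega>\<^sub>v (\<lambda>v. f0v v * V' j v)"
    and "j \<in> {1..r} \<Longrightarrow> (LINT v:\<Omega>\<^sub>v|lborel. f0v v * V' j v) = (if j = 1 then norm_v (\<lambda>w. 1) else 0)"
proof -
  let ?f = "lowrank r X S V" and ?K = "K_old r X S" and ?P = "{1..r} \<times> (UNIV :: 'd set)"
  from st have mr: "m \<le> r" and V_orth: "orthonormal_v r V"
    and X: "\<And>i. i \<in> {1..r} \<Longrightarrow> C1_on UNIV (X i)"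
    and VU: "\<And>a v. a \<in> {1..m} \<Longrightarrow> v \<in> \<Omega>\<^sub>v \<Longrightarrow> V a v = U a v"
    unfolding lowrank_state_def by auto
  from step obtain Nx Xt Nv Vt where
    aX: "augmented_X \<tau> r X S V Nx Xt" and aV: "augmented_V \<tau> r m X S V Nv Vt"
    and trunc: "truncation r m Nx Xt Nv Vt (S_new \<tau> r X S V Nx Xt Nv Vt) X' S' V'"
    unfolding dlr_step_def by blast
  from aX have Xt: "orthonormal_x Nx Xt"
    and X_span: "fspan UNIV (Xt ` {1..Nx}) = fspan UNIV
      (X ` {1..r} \<union> {(\<lambda>x. grad (X i) x $ s) |i s. i \<in> {1..r}} \<union> K_new \<tau> r X S V ` {1..r})"
    unfolding augmented_X_def by blast+
  from aV have Vt: "orthonormal_v Nv Vt" and Nv: "m \<le> Nv"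
    and VtU: "\<And>a v. a \<in> {1..m} \<Longrightarrow> v \<in> \<Omega>\<^sub>v \<Longrightarrow> Vt a v = U a v"
    and V_span: "fspan \<Omega>\<^sub>v (Vt ` {1..Nv}) =
       fspan \<Omega>\<^sub>v (U ` {1..m} \<union> L_new \<tau> r m X S V ` {m+1..r} \<union> V ` {m+1..r})"
    unfolding augmented_V_def by blast+
  from truncation_first_column[OF trunc m mr] obtain Q where
    X': "orthonormal_x r X'"
    and K': "\<And>x. K_old r X' S' 1 x = (\<Sum>k=1..Nx. Xt k x * S_new \<tau> r X S V Nx Xt Nv Vt k 1)"
    and U': "\<And>a v. a \<in> {1..m} \<Longrightarrow> v \<in> \<Omega>\<^sub>v \<Longrightarrow> V' a v = U a v"
    and W': "\<And>j v. j \<in> {1..r-m} \<Longrightarrow> v \<in> \<Omega>\<^sub>v \<Longrightarrow> V' (m + j) v = (\<Sum>i=1..Nv-m. Vt (m + i) v * Q i j)"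
    by blast
  have fin: "finite (X ` {1..r} \<union> {(\<lambda>x. grad (X i) x $ s) |i s. i \<in> {1..r}} \<union> K_new \<tau> r X S V ` {1..r})"
  proof -
    have "{(\<lambda>x. grad (X i) x $ s) |i s. i \<in> {1..r}} = (\<lambda>(i, s) x. grad (X i) x $ s) ` ?P"
      by auto
    then show ?thesis by simp
  qed
  have X_mem: "X i \<in> fspan UNIV (Xt ` {1..Nx})" if "i \<in> {1..r}" for i
    unfolding X_span using that by (intro mem_fspan[OF fin, of "X i"]) auto
  have dX_mem: "(\<lambda>x. grad (X i) x $ s) \<in> fspan UNIV (Xt ` {1..Nx})" if "i \<in> {1..r}" for i s
    unfolding X_span using that by (intro mem_fspan[OF fin, of "\<lambda>x. grad (X i) x $ s"]) auto
  \<comment> \<open>The augmented basis contains all derivatives of the old basis, so projecting \<open>\<partial>\<^sub>s K\<^sub>j\<close> is exact.\<close>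
  have dK_mem: "(\<lambda>x. grad (?K j) x $ s) \<in> fspan UNIV (Xt ` {1..Nx})" for j s
  proof -
    have "(\<lambda>x. grad (?K j) x $ s) = (\<lambda>x. \<Sum>i=1..r. S i j * grad (X i) x $ s)"
      using grad_K_old[where X=X and r=r, OF X] by (simp add: fun_eq_iff)
    then show ?thesis
      using fspan_sum[of "{1..r}" "\<lambda>i x. grad (X i) x $ s", OF dX_mem] by simp
  qed
  have V_mem: "V j \<in> fspan \<Omega>\<^sub>v (Vt ` {1..Nv})" if j: "j \<in> {1..r}" for j
  proof (cases "j \<le> m")
    case True
    then show ?thesis
      unfolding V_span using j by (intro mem_fspan[of _ "U j"]) (auto simp: VU)
  next
    case False
    then show ?thesis
      unfolding V_span using j by (intro mem_fspan[of _ "V j"]) auto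
  qed
  have Vt1: "Vt 1 v = V 1 v" if "v \<in> \<Omega>\<^sub>v" for v
    using that m by (simp add: VtU VU)
  have g: "RHS (f_proj r X S V Nx Xt Nv Vt) x v = RHS ?f x v" if "v \<in> \<Omega>\<^sub>v" for x v
    using f_proj_eq_lowrank[where X=X and V=V and r=r, OF Xt Vt X_mem V_mem] that by (rule RHS_cong)
  have pair: "pair_xv (\<lambda>x v. Xt k x * Vt 1 v) (RHS (f_proj r X S V Nx Xt Nv Vt))
      = - (\<Sum>p\<in>?P. ip_x (Xt k) (\<lambda>x. grad (?K (fst p)) x $ snd p) * ip_v (V 1) (\<lambda>v. v $ snd p * V (fst p) v))"
    if "k \<in> {1..Nx}" for k
  proof -
    have "pair_xv (\<lambda>x v. Xt k x * Vt 1 v) (RHS (f_proj r X S V Nx Xt Nv Vt))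
        = pair_xv (\<lambda>x v. Xt k x * V 1 v) (RHS ?f)"
      unfolding pair_xv_def set_lebesgue_integral_def
      by (intro Bochner_Integration.integral_cong refl) (auto simp: indicator_def Vt1[simplified] g)
    also have "\<dots> = - (\<Sum>p\<in>?P. ip_x (Xt k) (\<lambda>x. grad (?K (fst p)) x $ snd p) * ip_v (V 1) (\<lambda>v. v $ snd p * V (fst p) v))"
      using Xt that by (intro pair_xv_RHS[OF st m]) (simp add: orthonormal_x_def)
    finally show ?thesis .
  qed
  have "K_old r X' S' 1 x = (\<Sum>k=1..Nx. Xt k x * S_proj r X S V Xt Vt k 1
      - \<tau> * (\<Sum>p\<in>?P. ip_v (V 1) (\<lambda>v. v $ snd p * V (fst p) v)
           * (Xt k x * ip_x (Xt k) (\<lambda>x. grad (?K (fst p)) x $ snd p))))"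
    unfolding K' S_new_def
    by (intro sum.cong refl) (simp only: pair, simp add: right_diff_distrib sum_distrib_left ac_simps)
  also have "\<dots> = (\<Sum>k=1..Nx. Xt k x * S_proj r X S V Xt Vt k 1)
      - \<tau> * (\<Sum>p\<in>?P. ip_v (V 1) (\<lambda>v. v $ snd p * V (fst p) v)
           * (\<Sum>k=1..Nx. Xt k x * ip_x (Xt k) (\<lambda>x. grad (?K (fst p)) x $ snd p)))"
    by (simp only: sum_subtractf sum_distrib_left[symmetric] sum.swap[of _ _ "{1..Nx}"])
  also have "(\<Sum>k=1..Nx. Xt k x * S_proj r X S V Xt Vt k 1) = ?K 1 x"
    using m mr by (intro S_proj_first_column[where X=X and V=V and Vt=Vt, OF Xt V_orth _ X_mem Vt1]) auto
  finally show "K_old r X' S' 1 x = K_old r X S 1 x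
      - \<tau> * (\<Sum>p\<in>?P. ip_v (V 1) (\<lambda>v. v $ snd p * V (fst p) v) * grad (K_old r X S (fst p)) x $ snd p)"
    by (simp only: expansion_x[OF Xt dK_mem])
  show "orthonormal_x r X'"
    by (fact X')
  have r: "1 \<le> r" and V1: "\<forall>v\<in>\<Omega>\<^sub>v. V 1 v = U 1 v" and Nv1: "1 \<le> Nv"
    and VtU1: "\<forall>v\<in>\<Omega>\<^sub>v. Vt 1 v = U 1 v"
    using m mr Nv VU VtU by auto
  note mom = moments_orthonormal_v[OF V_orth r V1]
  note momt = moments_orthonormal_v[OF Vt Nv1 VtU1]
  have "set_integrable lborel \<Omega>\<^sub>v (\<lambda>v. f0v v * V' j v) \<and>
      (LINT v:\<Omega>\<^sub>v|lborel. f0v v * V' j v) = (if j = 1 then norm_v (\<lambda>w. 1) else 0)" if j: "j \<in> {1..r}"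
  proof (cases "j \<le> m")
    case True
    then have eq: "f0v v * V' j v = f0v v * V j v" if "v \<in> \<Omega>\<^sub>v" for v
      using j that by (simp add: U' VU)
    show ?thesis
      using set_integral_cong_v[of "\<lambda>v. f0v v * V' j v" "\<lambda>v. f0v v * V j v"] eq mom(2,3)[OF j] by simp
  next
    case False
    with j have jm: "j - m \<in> {1..r-m}" "m + (j - m) = j"
      by auto
    have eq: "f0v v * V' j v = (\<Sum>i=1..Nv-m. Q i (j - m) * (f0v v * Vt (m + i) v))" if "v \<in> \<Omega>\<^sub>v" for v
      using W'[OF jm(1) that] unfolding jm(2) by (simp add: sum_distrib_left ac_simps)
    have int: "set_integrable lborel \<Omega>\<^sub>v (\<lambda>v. f0v v * Vt (m + i) v)"
      and z: "(LINT v:\<Omega>\<^sub>v|lborel. f0v v * Vt (m + i) v) = 0" if "i \<in> {1..Nv-m}" for i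
      using momt(2,3)[of "m + i"] that m Nv by auto
    show ?thesis
      using set_integral_cong_v[of "\<lambda>v. f0v v * V' j v"
          "\<lambda>v. \<Sum>i=1..Nv-m. Q i (j - m) * (f0v v * Vt (m + i) v)"]
        set_integral_sum_mult[of "{1..Nv-m}" lborel \<Omega>\<^sub>v "\<lambda>i v. f0v v * Vt (m + i) v" "\<lambda>i. Q i (j - m)"]
        eq int z False m by simp
  qed
  then show "j \<in> {1..r} \<Longrightarrow> set_integrable lborel \<Omega>\<^sub>v (\<lambda>v. f0v v * V' j v)"
    and "j \<in> {1..r} \<Longrightarrow> (LINT v:\<Omega>\<^sub>v|lborel. f0v v * V' j v) = (if j = 1 then norm_v (\<lambda>w. 1) else 0)"
    by blast+
qed

lemma integral_grad_K_old_eq_0: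
  assumes "orthonormal_x r X" and X: "\<And>i. i \<in> {1..r} \<Longrightarrow> C1_on UNIV (X i)"
  shows "set_integrable lborel \<Omega>\<^sub>x (\<lambda>x. grad (K_old r X S j) x $ s)"
    and "(LINT x:\<Omega>\<^sub>x|lborel. grad (K_old r X S j) x $ s) = 0"
proof -
  have C1: "C1_on UNIV (K_old r X S j)"
    using C1_on_K_old[where X=X and r=r, OF X] .
  have per: "K_old r X S j (x + axis s (hi $ s - lo $ s)) = K_old r X S j x" for x
    using assms(1) by (simp add: K_old_def orthonormal_x_def periodic_def)
  show int: "set_integrable lborel \<Omega>\<^sub>x (\<lambda>x. grad (K_old r X S j) x $ s)"
    unfolding set_integrable_def \<Omega>\<^sub>x_def using C1
    by (intro borel_integrable_compact compact_cbox continuous_intros)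
      (auto simp: C1_on_def intro: continuous_on_subset)
  show "(LINT x:\<Omega>\<^sub>x|lborel. grad (K_old r X S j) x $ s) = 0"
    using set_borel_integral_eq_integral(2)[OF int] integral_cbox_partial_eq_0[OF C1 per box_nonempty]
    by (simp add: \<Omega>\<^sub>x_def)
qed

lemma continuity_equation:
  assumes st: "lowrank_state r m X S V" and m: "1 \<le> m" and \<tau>: "0 < \<tau>"
    and step: "dlr_step \<tau> r m X S V X' S' V'"
  shows "(density (lowrank r X' S' V') x - density (lowrank r X S V) x) / \<tau>
      + divergence (current (lowrank r X S V)) x = 0"
    and "mass (lowrank r X' S' V') = mass (lowrank r X S V)"
proof -
  let ?n = "norm_v (\<lambda>w. 1)" and ?P = "{1..r} \<times> (UNIV :: 'd set)"
  let ?\<kappa> = "\<lambda>p. ip_v (V 1) (\<lambda>v. v $ snd p * V (fst p) v)"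
  let ?dK = "\<lambda>p x. grad (K_old r X S (fst p)) x $ snd p"
  from st m have r: "1 \<le> r" and X_orth: "orthonormal_x r X" and V_orth: "orthonormal_v r V"
    and X: "\<And>i. i \<in> {1..r} \<Longrightarrow> C1_on UNIV (X i)"
    and vV: "\<And>j s. j \<in> {1..r} \<Longrightarrow> in_L2 \<Omega>\<^sub>v f0v (\<lambda>v. v $ s * V j v)"
    and V1: "\<forall>v\<in>\<Omega>\<^sub>v. V 1 v = U 1 v"
    unfolding lowrank_state_def by auto
  note mom = moments_orthonormal_v[OF V_orth r V1]
  have old: "density (lowrank r X S V) x = K_old r X S 1 x * ?n"
    "mass (lowrank r X S V) = (LINT x:\<Omega>\<^sub>x|lborel. K_old r X S 1 x) * ?n"
    using mom(2,3) X_orth by (intro density_mass_lowrank[OF r]; blast)+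
  note step1 = dlr_step_first_coefficient[OF st m step]
  have new: "density (lowrank r X' S' V') x = K_old r X' S' 1 x * ?n"
    "mass (lowrank r X' S' V') = (LINT x:\<Omega>\<^sub>x|lborel. K_old r X' S' 1 x) * ?n"
    using step1(2,3,4) by (intro density_mass_lowrank[OF r]; blast)+
  have \<kappa>: "ip_v (\<lambda>v. 1) h = ip_v (V 1) h * ?n" for h
  proof -
    have "ip_v (V 1) h = ip_v (\<lambda>v. 1 / ?n) h"
      using V1 by (intro ip_v_cong) (simp_all add: U_def)
    then show ?thesis
      using mom(1) by (simp add: ip_v_def)
  qed
  have div: "divergence (current (lowrank r X S V)) x = (\<Sum>p\<in>?P. ?\<kappa> p * ?dK p x) * ?n"
    using divergence_current[where X=X and V=V and r=r, OF X vV] by (simp add: \<kappa> sum_distrib_left sum_distrib_right ac_simps)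
  show "(density (lowrank r X' S' V') x - density (lowrank r X S V) x) / \<tau>
      + divergence (current (lowrank r X S V)) x = 0"
    using \<tau> unfolding div old(1) new(1) step1(1) by (simp add: field_simps)
  have intX: "set_integrable lborel \<Omega>\<^sub>x (K_old r X S 1)"
    using C1_on_imp_continuous_on[OF C1_on_K_old[where X=X and r=r, OF X]]
    unfolding set_integrable_def \<Omega>\<^sub>x_def
    by (intro borel_integrable_compact compact_cbox) (auto intro: continuous_on_subset)
  have zero: "(LINT x:\<Omega>\<^sub>x|lborel. (\<Sum>p\<in>?P. ?\<kappa> p * ?dK p x)) = 0"
    and int: "set_integrable lborel \<Omega>\<^sub>x (\<lambda>x. \<Sum>p\<in>?P. ?\<kappa> p * ?dK p x)"
    using set_integral_sum_mult[of ?P lborel \<Omega>\<^sub>x ?dK ?\<kappa>]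
      integral_grad_K_old_eq_0[where X=X and r=r, OF X_orth X] by simp_all
  have "(LINT x:\<Omega>\<^sub>x|lborel. K_old r X' S' 1 x) = (LINT x:\<Omega>\<^sub>x|lborel. K_old r X S 1 x)"
    unfolding step1(1) by (simp add: set_integral_diff(2)[OF intX] int zero del: One_nat_def)
  then show "mass (lowrank r X' S' V') = mass (lowrank r X S V)"
    by (simp only: old(2) new(2))
qed

end

theorem theorem1:
  fixes lo hi :: "real^'d" and \<Omega>\<^sub>v :: "(real^'d) set" and f0v :: "real^'d \<Rightarrow> real"
    and e :: "nat \<Rightarrow> 'd" and c \<tau> :: real and r m :: nat
    and X V X' V' :: "nat \<Rightarrow> real^'d \<Rightarrow> real" and S S' :: "nat \<Rightarrow> nat \<Rightarrow> real"
    and f f' :: "real^'d \<Rightarrow> real^'d \<Rightarrow> real"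
  assumes "vp_setting lo hi \<Omega>\<^sub>v f0v e c"
    and "1 \<le> m"
    and "0 < \<tau>"
    and "vp_setting.lowrank_state lo hi \<Omega>\<^sub>v f0v e c r m X S V"
    and "vp_setting.dlr_step lo hi \<Omega>\<^sub>v f0v e c \<tau> r m X S V X' S' V'"
    and "f = vp_setting.lowrank f0v r X S V"
    and "f' = vp_setting.lowrank f0v r X' S' V'"
  shows "(\<forall>x. (vp_setting.density \<Omega>\<^sub>v f' x - vp_setting.density \<Omega>\<^sub>v f x) / \<tau>
              + divergence (vp_setting.current \<Omega>\<^sub>v f) x = 0)
       \<and> vp_setting.mass lo hi \<Omega>\<^sub>v f' = vp_setting.mass lo hi \<Omega>\<^sub>v f"
proof -
  interpret vp_setting lo hi \<Omega>\<^sub>v f0v e c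
    by fact
  show ?thesis
    using continuity_equation[of r m X S V \<tau> X' S' V'] assms(2-) by blast
qed

end
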